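(* Let $\kappa,T_h>0$, $0<\delta_{\min}<\delta_{\max}$, $\epsilon=\delta_{\max}-\delta_{\min}$, $p_0\in[0,1]$. For $\tau>0$ consider a two-level system, initially excited with probability $p_0$, whose gap is driven at constant rate, $\delta(t)=\delta_{\max}-\epsilon t/\tau$, $t\in[0,\tau]$, with partial thermalizations with respect to a bath at temperature $T_h$, and let $W$ be the (continuous-process) work, with mean $\mu_W(\tau)$ and variance $\sigma_W^2(\tau)$. Then $$\sigma_W^2(\tau)\ \ge\ (1-p_0)\left(\frac{Z(\delta_{\min})}{Z(\delta_{\max})}\right)^{-\frac{\kappa\tau T_h}{\epsilon}}\mu_W(\tau)^2+p_0\,e^{-\kappa\tau}\left(\frac{Z(\delta_{\min})}{Z(\delta_{\max})}\right)^{\frac{\kappa\tau T_h}{\epsilon}}\big(\epsilon-\mu_W(\tau)\big)^2 .$$ Moreover, the lower bound is saturated in the adiabatic limit, where both $\sigma_W^2(\tau)$ and the right-hand side converge to the same value, $$\lim_{\tau\to0}\sigma_W^2(\tau)=p_0(1-p_0)\epsilon^2,$$ and in the isothermal limit, where both $\sigma_W^2(\tau)$ and the right-hand side converge to the same value, $$\lim_{\tau\to\infty}\sigma_W^2(\tau)=0.$$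
   Context: $\gamma_h(\delta)=\frac{1}{1+e^{\delta/T_h}}$; $Z(\delta)=1+e^{-\delta/T_h}$. Discrete process with $L\ge\kappa\tau$ steps: put $\Delta t=\tau/L$. Let $X_0,\dots,X_L\in\{0,1\}$ be a Markov chain ($0$ = ground, $1$ = excited) with $\Pr[X_0=1]=p_0$ and $$\Pr[X_l=1\mid X_{l-1}=0]=\kappa\Delta t\,\gamma_h(\delta(l\Delta t)),\qquad \Pr[X_l=0\mid X_{l-1}=1]=\kappa\Delta t\,\big(1-\gamma_h(\delta(l\Delta t))\big).$$ The work of the discrete process is $W_L=\sum_{l=1}^{L}X_{l-1}\big(\delta((l-1)\Delta t)-\delta(l\Delta t)\big)$. The work $W$ of the continuous process is the random variable to which $W_L$ converges in probability as $L\to\infty$ (such convergence is assumed). The mean $\mu_W(\tau)$ of $W$ is the average work $$\mu_W(\tau)=T_h\log\frac{Z(\delta_{\min})}{Z(\delta_{\max})}+\frac{\epsilon p_0}{\kappa\tau}\big(1-e^{-\kappa\tau}\big)-\frac{\epsilon}{\kappa\tau}\Big\{\mathcal{G}(\tau)-e^{-\kappa\tau}\mathcal{G}(0)\Big\},\qquad \mathcal{G}(t)=-\sum_{n=1}^\infty\frac{\big(-e^{-\delta(t)/T_h}\big)^n}{\frac{n\epsilon}{\kappa\tau T_h}+1},$$ equivalently $\mu_W(\tau)=\frac{\epsilon}{\tau}\int_0^\tau p(t)\,dt$ where $p'(t)=\kappa(\gamma_h(\delta(t))-p(t))$, $p(0)=p_0$. *)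

theory Defs
  imports "HOL-Probability.Probability"
begin

text \<open>Temperatures are in units with Boltzmann constant \<open>1\<close>.\<close>

definition excitation_prob :: "real \<Rightarrow> real \<Rightarrow> real" where
  "excitation_prob T \<delta> = 1 / (1 + exp (\<delta> / T))"

definition partition_function :: "real \<Rightarrow> real \<Rightarrow> real" where
  "partition_function T \<delta> = 1 + exp (- \<delta> / T)"

definition linear_gap :: "real \<Rightarrow> real \<Rightarrow> real \<Rightarrow> real \<Rightarrow> real" where
  "linear_gap \<delta>min \<delta>max \<tau> t = \<delta>max - (\<delta>max - \<delta>min) * t / \<tau>"

text \<open>
  Finite-horizon, possibly time-inhomogeneous Markov chains \<open>X 0, \<dots>, X L\<close> with values in a
  finite set \<open>S\<close>.  Conditional probabilities are only constrained when the conditioning event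
  has positive probability, since \<^const>\<open>cond_prob\<close> is \<open>0\<close> on null events.
\<close>

definition markov_chain :: "'a measure \<Rightarrow> 's set \<Rightarrow> nat \<Rightarrow> (nat \<Rightarrow> 'a \<Rightarrow> 's) \<Rightarrow> bool" where
  "markov_chain M S L X \<longleftrightarrow>
     (\<forall>l\<le>L. X l \<in> measurable M (count_space S)) \<and>
     (\<forall>l<L. \<forall>x. \<P>(\<omega> in M. \<forall>i\<le>l. X i \<omega> = x i) > 0 \<longrightarrow>
        \<P>(\<omega> in M. X (Suc l) \<omega> = x (Suc l) \<bar> \<forall>i\<le>l. X i \<omega> = x i) =
        \<P>(\<omega> in M. X (Suc l) \<omega> = x (Suc l) \<bar> X l \<omega> = x l))"

text \<open>State \<open>0\<close> is the ground state, state \<open>1\<close> the excited state; \<open>\<delta>\<close> is the gap as a function of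
  time, and the \<open>L\<close> steps have length \<open>\<tau> / L\<close>.\<close>

definition thermalization_chain ::
  "real \<Rightarrow> real \<Rightarrow> real \<Rightarrow> (real \<Rightarrow> real) \<Rightarrow> real \<Rightarrow> nat \<Rightarrow> 'a measure \<Rightarrow> (nat \<Rightarrow> 'a \<Rightarrow> nat) \<Rightarrow> bool"
where
  "thermalization_chain \<kappa> T p0 \<delta> \<tau> L M X \<longleftrightarrow>
     markov_chain M {0, 1} L X \<and>
     \<P>(\<omega> in M. X 0 \<omega> = 1) = p0 \<and>
     (\<forall>l\<in>{1..L}.
        (\<P>(\<omega> in M. X (l - 1) \<omega> = 0) > 0 \<longrightarrow>
           \<P>(\<omega> in M. X l \<omega> = 1 \<bar> X (l - 1) \<omega> = 0) =
             \<kappa> * (\<tau> / real L) * excitation_prob T (\<delta> (real l * (\<tau> / real L)))) \<and>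
        (\<P>(\<omega> in M. X (l - 1) \<omega> = 1) > 0 \<longrightarrow>
           \<P>(\<omega> in M. X l \<omega> = 0 \<bar> X (l - 1) \<omega> = 1) =
             \<kappa> * (\<tau> / real L) * (1 - excitation_prob T (\<delta> (real l * (\<tau> / real L))))))"

definition discrete_work :: "(real \<Rightarrow> real) \<Rightarrow> real \<Rightarrow> nat \<Rightarrow> (nat \<Rightarrow> 'a \<Rightarrow> nat) \<Rightarrow> 'a \<Rightarrow> real" where
  "discrete_work \<delta> \<tau> L X \<omega> =
     (\<Sum>l = 1..L. real (X (l - 1) \<omega>) *
        (\<delta> (real (l - 1) * (\<tau> / real L)) - \<delta> (real l * (\<tau> / real L))))"

definition converges_in_probability ::
  "'a measure \<Rightarrow> (nat \<Rightarrow> 'a \<Rightarrow> real) \<Rightarrow> ('a \<Rightarrow> real) \<Rightarrow> bool" where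
  "converges_in_probability M Y Z \<longleftrightarrow>
     (\<forall>e>0. (\<lambda>n. \<P>(\<omega> in M. \<bar>Y n \<omega> - Z \<omega>\<bar> > e)) \<longlonglongrightarrow> 0)"

text \<open>\<open>X L\<close> is the chain with \<open>L\<close> steps.  All chains live on the same probability space, but
  their joint distribution across different \<open>L\<close> is left open.\<close>

definition continuous_process_work ::
  "real \<Rightarrow> real \<Rightarrow> real \<Rightarrow> (real \<Rightarrow> real) \<Rightarrow> real \<Rightarrow>
   'a measure \<Rightarrow> (nat \<Rightarrow> nat \<Rightarrow> 'a \<Rightarrow> nat) \<Rightarrow> ('a \<Rightarrow> real) \<Rightarrow> bool" where
  "continuous_process_work \<kappa> T p0 \<delta> \<tau> M X W \<longleftrightarrow>
     prob_space M \<and>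
     (\<forall>L. real L \<ge> \<kappa> * \<tau> \<longrightarrow> thermalization_chain \<kappa> T p0 \<delta> \<tau> L M (X L)) \<and>
     W \<in> borel_measurable M \<and>
     converges_in_probability M (\<lambda>L. discrete_work \<delta> \<tau> L (X L)) W"

end

theory Submission
  imports Defs
begin

text \<open>
  Under a linear drive \<open>W_L\<close> is \<open>\<epsilon> / L\<close> times the number of excited steps.  The trajectory that
  always stays in the ground state has \<open>W_L = 0\<close>, the one that always stays excited has
  \<open>W_L = \<epsilon>\<close>, so the variance is at least \<open>P(ground) * \<mu>\<^sup>2 + P(excited) * (\<epsilon> - \<mu>)\<^sup>2\<close>.  The
  two probabilities are products of survival probabilities; they tend to \<open>(1 - p0) * exp (- A)\<close> and
  \<open>p0 * exp (- (\<kappa> * \<tau> - A))\<close>, where \<open>A\<close> is \<open>\<kappa>\<close> times the time integral of the excitation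
  probability, i.e. \<open>\<kappa> * \<tau> * T / \<epsilon>\<close> times the increment of \<open>ln Z\<close>.  Since the works are bounded,
  mean and variance pass to the limit.

  As \<open>\<tau> \<rightarrow> 0\<close> the two trajectories exhaust the probability and \<open>W\<close> becomes a two-point variable.
  As \<open>\<tau> \<rightarrow> \<infinity>\<close>, correlations of the chain decay like \<open>(1 - \<kappa> * \<tau> / L) ^ k\<close> over \<open>k\<close> steps, whence
  the variance is at most \<open>2 * \<epsilon>\<^sup>2 / (\<kappa> * \<tau>)\<close>.
\<close>

section \<open>Convergence in probability of bounded variables\<close>

text \<open>Once \<open>W\<close> leaves the interval enlarged by \<open>e\<close>, it differs from
  every bounded \<open>Y n\<close> by more than \<open>e\<close>, so this event has probability
  below a null sequence. Letting \<open>e\<close> run through the countable sequence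
  \<open>1 / (k + 1)\<close> keeps the exceptional set null.\<close>

lemma (in prob_space) converges_in_probability_AE_bounded:
  fixes Y :: "nat \<Rightarrow> 'a \<Rightarrow> real"
  assumes Y: "\<And>n. n \<ge> N \<Longrightarrow> Y n \<in> borel_measurable M"
    and bd: "\<And>n \<omega>. n \<ge> N \<Longrightarrow> \<omega> \<in> space M \<Longrightarrow> Y n \<omega> \<in> {a..b}"
    and W[measurable]: "W \<in> borel_measurable M"
    and conv: "converges_in_probability M Y W"
  shows "AE \<omega> in M. W \<omega> \<in> {a..b}"
proof -
  have small: "AE \<omega> in M. W \<omega> \<in> {a - e..b + e}" if "e > 0" for e
  proof -
    have lim: "(\<lambda>n. \<P>(\<omega> in M. \<bar>Y n \<omega> - W \<omega>\<bar> > e)) \<longlonglongrightarrow> 0"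
      using conv \<open>e > 0\<close> by (simp add: converges_in_probability_def)
    have "\<P>(\<omega> in M. W \<omega> \<notin> {a - e..b + e}) \<le> 0"
    proof (rule Lim_bounded2[OF lim, of N], intro allI impI)
      fix n assume n: "N \<le> n"
      note Y[OF n, measurable]
      show "\<P>(\<omega> in M. W \<omega> \<notin> {a - e..b + e}) \<le> \<P>(\<omega> in M. \<bar>Y n \<omega> - W \<omega>\<bar> > e)"
      proof (rule finite_measure_mono)
        show "{\<omega> \<in> space M. W \<omega> \<notin> {a - e..b + e}} \<subseteq> {\<omega> \<in> space M. e < \<bar>Y n \<omega> - W \<omega>\<bar>}"
          using bd[OF n] by fastforce
      qed measurable
    qed
    then have "\<P>(\<omega> in M. W \<omega> \<notin> {a - e..b + e}) = 0"
      by (intro antisym) auto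
    then show ?thesis
      by (subst (asm) prob_eq_0) (auto simp del: atLeastAtMost_iff)
  qed
  have "AE \<omega> in M. \<forall>k. W \<omega> \<in> {a - inverse (real (Suc k))..b + inverse (real (Suc k))}"
    unfolding AE_all_countable by (intro allI small) simp
  then show ?thesis
  proof eventually_elim
    case (elim \<omega>)
    have "(\<lambda>k. a - inverse (real (Suc k))) \<longlonglongrightarrow> a - 0" "(\<lambda>k. b + inverse (real (Suc k))) \<longlonglongrightarrow> b + 0"
      by (intro tendsto_intros LIMSEQ_inverse_real_of_nat)+
    then show ?case
      using elim by (auto intro: LIMSEQ_le_const LIMSEQ_le_const2)
  qed
qed

text \<open>The difference of expectations splits along the event
  \<open>\<bar>Y n - W\<bar> > e\<close>: off it the Lipschitz condition costs at most
  \<open>C * e\<close>, on it at most \<open>C * (b - a)\<close>, as both variables lie in the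
  interval almost surely. It is applied to the identity and the square. The threshold
  \<open>N\<close> allows for chains that are controlled only for enough steps.\<close>

lemma (in prob_space) bounded_convergence_in_probability:
  fixes Y :: "nat \<Rightarrow> 'a \<Rightarrow> real" and h :: "real \<Rightarrow> real"
  assumes Y: "\<And>n. n \<ge> N \<Longrightarrow> Y n \<in> borel_measurable M"
    and bd: "\<And>n \<omega>. n \<ge> N \<Longrightarrow> \<omega> \<in> space M \<Longrightarrow> Y n \<omega> \<in> {a..b}"
    and W[measurable]: "W \<in> borel_measurable M"
    and conv: "converges_in_probability M Y W"
    and h[measurable]: "h \<in> borel_measurable borel"
    and lip: "C-lipschitz_on {a..b} h"
  shows "(\<lambda>n. expectation (\<lambda>\<omega>. h (Y n \<omega>))) \<longlonglongrightarrow> expectation (\<lambda>\<omega>. h (W \<omega>))"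
proof -
  have AEW: "AE \<omega> in M. W \<omega> \<in> {a..b}"
    by (rule converges_in_probability_AE_bounded[OF Y bd W conv])
  have "a \<le> b"
    using bd[of N] not_empty by (force simp: ex_in_conv[symmetric])
  have "C \<ge> 0"
    using lip by (rule lipschitz_on_nonneg)
  have "bounded (h ` {a..b})"
    by (intro compact_imp_bounded compact_continuous_image lipschitz_on_continuous_on[OF lip]) auto
  then obtain B where B: "\<And>x. x \<in> {a..b} \<Longrightarrow> \<bar>h x\<bar> \<le> B"
    unfolding bounded_iff by force
  have intW: "integrable M (\<lambda>\<omega>. h (W \<omega>))"
    by (rule integrable_const_bound[of _ B]) (use AEW B in \<open>auto elim!: eventually_mono simp del: atLeastAtMost_iff\<close>)
  have bound: "\<bar>expectation (\<lambda>\<omega>. h (Y n \<omega>)) - expectation (\<lambda>\<omega>. h (W \<omega>))\<bar>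
      \<le> C * (e + (b - a) * \<P>(\<omega> in M. \<bar>Y n \<omega> - W \<omega>\<bar> > e))" if n: "n \<ge> N" and "e > 0" for n e
  proof -
    note Y[OF n, measurable]
    let ?A = "{\<omega> \<in> space M. \<bar>Y n \<omega> - W \<omega>\<bar> > e}"
    have [measurable]: "?A \<in> sets M" by measurable
    have intY: "integrable M (\<lambda>\<omega>. h (Y n \<omega>))"
      by (rule integrable_const_bound[of _ B]) (use bd[OF n] B in auto)
    have intA: "integrable M (\<lambda>\<omega>. C * (e + (b - a) * indicator ?A \<omega>))"
      by (intro integrable_mult_right integrable_add integrable_const integrable_real_indicator)
        (auto simp: emeasure_eq_measure)
    have "\<bar>expectation (\<lambda>\<omega>. h (Y n \<omega>)) - expectation (\<lambda>\<omega>. h (W \<omega>))\<bar>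
        = \<bar>expectation (\<lambda>\<omega>. h (Y n \<omega>) - h (W \<omega>))\<bar>"
      using intY intW by simp
    also have "\<dots> \<le> expectation (\<lambda>\<omega>. \<bar>h (Y n \<omega>) - h (W \<omega>)\<bar>)"
      by (rule integral_abs_bound)
    also have "\<dots> \<le> expectation (\<lambda>\<omega>. C * (e + (b - a) * indicator ?A \<omega>))"
    proof (rule integral_mono_AE[OF _ intA])
      show "integrable M (\<lambda>\<omega>. \<bar>h (Y n \<omega>) - h (W \<omega>)\<bar>)"
        using intY intW by simp
      show "AE \<omega> in M. \<bar>h (Y n \<omega>) - h (W \<omega>)\<bar> \<le> C * (e + (b - a) * indicator ?A \<omega>)"
        using AEW AE_space
      proof eventually_elim
        case (elim \<omega>)
        have "\<bar>h (Y n \<omega>) - h (W \<omega>)\<bar> \<le> C * \<bar>Y n \<omega> - W \<omega>\<bar>"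
          using lipschitz_onD[OF lip bd[OF n elim(2)] elim(1)] by (simp add: dist_real_def)
        also have "\<bar>Y n \<omega> - W \<omega>\<bar> \<le> e + (b - a) * indicator ?A \<omega>"
          using bd[OF n elim(2)] elim \<open>e > 0\<close> by (auto simp: indicator_def)
        finally show ?case using \<open>C \<ge> 0\<close> by (simp add: mult_left_mono)
      qed
    qed
    also have "\<dots> = C * (e + (b - a) * prob ?A)"
      by (subst integral_mult_right_zero, subst Bochner_Integration.integral_add)
        (auto simp: prob_space emeasure_eq_measure)
    finally show ?thesis .
  qed
  show ?thesis
  proof (rule LIMSEQ_I)
    fix r :: real assume "r > 0"
    \<comment> \<open>\<open>C + 1\<close> instead of \<open>C\<close> covers \<open>C = 0\<close>;
      then \<open>C * e\<close> is strictly below \<open>r\<close>, which leaves room for the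
      vanishing exceptional term.\<close>
    define e where "e = r / (2 * (C + 1))"
    have "e > 0" using \<open>r > 0\<close> \<open>C \<ge> 0\<close> by (simp add: e_def)
    have "C * e < r"
    proof -
      have "(C + 1) * e = r / 2" using \<open>C \<ge> 0\<close> by (simp add: e_def field_simps)
      then show ?thesis using \<open>r > 0\<close> \<open>e > 0\<close> by (simp add: algebra_simps)
    qed
    have "(\<lambda>n. \<P>(\<omega> in M. \<bar>Y n \<omega> - W \<omega>\<bar> > e)) \<longlonglongrightarrow> 0"
      using conv \<open>e > 0\<close> by (simp add: converges_in_probability_def)
    then have "(\<lambda>n. C * (e + (b - a) * \<P>(\<omega> in M. \<bar>Y n \<omega> - W \<omega>\<bar> > e))) \<longlonglongrightarrow> C * (e + (b - a) * 0)"
      by (intro tendsto_intros)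
    then have "\<forall>\<^sub>F n in sequentially. C * (e + (b - a) * \<P>(\<omega> in M. \<bar>Y n \<omega> - W \<omega>\<bar> > e)) < r"
      using \<open>C * e < r\<close> by (intro order_tendstoD(2)[where y = "C * (e + (b - a) * 0)"]) simp_all
    then have "\<forall>\<^sub>F n in sequentially.
        norm (expectation (\<lambda>\<omega>. h (Y n \<omega>)) - expectation (\<lambda>\<omega>. h (W \<omega>))) < r"
      using eventually_ge_at_top[of N]
      by eventually_elim (smt (verit) bound[OF _ \<open>e > 0\<close>] real_norm_def)
    then show "\<exists>no. \<forall>n\<ge>no. norm (expectation (\<lambda>\<omega>. h (Y n \<omega>)) - expectation (\<lambda>\<omega>. h (W \<omega>))) < r"
      by (simp add: eventually_sequentially)
  qed
qed

lemma (in prob_space) expectation_sum_indicator: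
  fixes c :: "'b \<Rightarrow> real"
  assumes "\<And>i. i \<in> I \<Longrightarrow> A i \<in> sets M"
  shows "expectation (\<lambda>\<omega>. \<Sum>i\<in>I. c i * indicator (A i) \<omega>) = (\<Sum>i\<in>I. c i * prob (A i))"
  using assms
  by (subst Bochner_Integration.integral_sum)
    (auto simp: emeasure_eq_measure intro!: sum.cong integrable_mult_right integrable_real_indicator
      dest: sets.sets_into_space[THEN Int_absorb2])

section \<open>Elementary estimates\<close>

lemma excitation_prob_bounds: "0 < excitation_prob T d" "excitation_prob T d < 1"
  by (auto simp: excitation_prob_def add_pos_pos)

lemma partition_function_pos: "partition_function T d > 0"
  by (simp add: partition_function_def add_pos_pos)

text \<open>Up to sign, the excitation probability is the slope of the convex function \<open>ln Z\<close>.\<close>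

lemma excitation_prob_le_ln_partition_function:
  assumes "T > 0"
  shows "excitation_prob T d * u
    \<le> ln (partition_function T (d - T * u)) - ln (partition_function T d)"
proof -
  let ?g = "excitation_prob T d"
  have conv: "convex_on UNIV (exp :: real \<Rightarrow> real)"
    by (rule exp_convex)
  have g: "?g = exp (- d / T) / partition_function T d"
    by (simp add: excitation_prob_def partition_function_def exp_minus field_simps add_pos_pos)
  \<comment> \<open>Jensen's inequality for the variable equal to \<open>u\<close> with the
    excitation probability and to 0 otherwise; its exponential moment is a quotient of partition
    functions.\<close>
  have "exp (?g * u) \<le> (1 - ?g) * exp 0 + ?g * exp u"
    using convex_onD[OF conv, of ?g 0 u] excitation_prob_bounds[of T d] by simp
  also have "\<dots> = partition_function T (d - T * u) / partition_function T d"
  proof -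
    have "exp (- (d - T * u) / T) = exp (- d / T) * exp u"
      using assms by (simp add: exp_add[symmetric] field_simps)
    then have "partition_function T (d - T * u) = 1 + exp (- d / T) * exp u"
      by (simp only: partition_function_def)
    moreover have "partition_function T d = 1 + exp (- d / T)"
      by (simp only: partition_function_def)
    ultimately show ?thesis
      unfolding g using partition_function_pos[of T d] by (simp add: field_simps)
  qed
  finally have "exp (?g * u) \<le> partition_function T (d - T * u) / partition_function T d" .
  then have "?g * u \<le> ln (partition_function T (d - T * u) / partition_function T d)"
    using partition_function_pos by (subst ln_ge_iff) auto
  then show ?thesis
    using partition_function_pos[of T] by (subst (asm) ln_divide_pos) auto
qed

text \<open>The bound \<open>ln (1 - x) \<ge> - x - 2 * x\<^sup>2\<close> on
  \<open>[0, 1/2]\<close>, summed over the factors. Later \<open>a\<close> is of order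
  \<open>1 / n\<close>, so the correction \<open>2 * n * a\<^sup>2\<close> vanishes in the
  limit.\<close>

lemma prod_one_minus_ge_exp:
  fixes x :: "nat \<Rightarrow> real"
  assumes "\<And>i. i < n \<Longrightarrow> 0 \<le> x i" "\<And>i. i < n \<Longrightarrow> x i \<le> a" "a \<le> 1 / 2"
  shows "exp (- (\<Sum>i<n. x i) - 2 * real n * a\<^sup>2) \<le> (\<Prod>i<n. 1 - x i)"
proof -
  have "exp (- (\<Sum>i<n. x i) - 2 * real n * a\<^sup>2) = (\<Prod>i<n. exp (- x i - 2 * a\<^sup>2))"
    by (simp add: exp_sum[symmetric] sum_subtractf sum_negf)
  also have "\<dots> \<le> (\<Prod>i<n. 1 - x i)"
  proof (intro prod_mono conjI)
    fix i assume "i \<in> {..<n}"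
    then have x: "0 \<le> x i" "x i \<le> a" using assms by auto
    then have "- x i - 2 * a\<^sup>2 \<le> - x i - 2 * (x i)\<^sup>2"
      by (simp add: power_mono)
    also have "\<dots> \<le> ln (1 - x i)"
      using x assms(3) by (intro ln_one_minus_pos_lower_bound) auto
    finally show "exp (- x i - 2 * a\<^sup>2) \<le> 1 - x i"
      using x assms(3) by (subst (asm) ln_ge_iff) auto
  qed simp
  finally show ?thesis .
qed

section \<open>Moments of the discrete chain\<close>

text \<open>One chain with a fixed number of steps. The condition \<open>steps\<close> keeps the
  resampling probability per step at most 1 and, with positive rate and duration, forces
  \<open>L\<close> to be nonzero.\<close>

locale thermal_chain = prob_space M for M :: "'a measure" +
  fixes \<kappa> T p0 \<tau> :: real and \<delta> :: "real \<Rightarrow> real" and L :: nat and X :: "nat \<Rightarrow> 'a \<Rightarrow> nat"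
  assumes chain: "thermalization_chain \<kappa> T p0 \<delta> \<tau> L M X"
    and rate_pos: "\<kappa> > 0" and tau_pos: "\<tau> > 0" and steps: "\<kappa> * \<tau> \<le> real L"
begin

section \<open>Step parameters and measurability\<close>

definition a :: real where "a = \<kappa> * (\<tau> / real L)"

text \<open>The equilibrium excitation probability at the end of step \<open>l\<close>. It governs
  the transition into \<open>X l\<close>, so transitions out of \<open>X l\<close> involve
  \<open>g (Suc l)\<close>.\<close>

definition g :: "nat \<Rightarrow> real" where "g l = excitation_prob T (\<delta> (real l * (\<tau> / real L)))"

lemma L_pos: "0 < L"
  using steps mult_pos_pos[OF rate_pos tau_pos] by (cases L) auto

lemma a_bounds: "0 < a" "a \<le> 1"
  using rate_pos tau_pos L_pos steps by (auto simp: a_def field_simps)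

lemma g_bounds: "0 < g l" "g l < 1"
  by (auto simp: g_def excitation_prob_bounds)

lemma X_measurable: "l \<le> L \<Longrightarrow> X l \<in> measurable M (count_space {0, 1})"
  using chain by (simp add: thermalization_chain_def markov_chain_def)

lemma X_values: "l \<le> L \<Longrightarrow> \<omega> \<in> space M \<Longrightarrow> X l \<omega> = 0 \<or> X l \<omega> = 1"
  using measurable_space[OF X_measurable] by fastforce

lemma X_measurable_UNIV: "l \<le> L \<Longrightarrow> X l \<in> measurable M (count_space UNIV)"
  using measurable_comp[OF X_measurable, of l "\<lambda>x. x" "count_space UNIV"] by (simp add: comp_def)

lemma X_measurable_real: "l \<le> L \<Longrightarrow> (\<lambda>\<omega>. real (X l \<omega>)) \<in> borel_measurable M"
  using measurable_compose[OF X_measurable, of l real borel] by simp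

section \<open>Histories and the Markov property\<close>

lemma history_sets: "l \<le> L \<Longrightarrow> {\<omega> \<in> space M. \<forall>i\<le>l. X i \<omega> = x i} \<in> sets M"
proof -
  assume l: "l \<le> L"
  have "{\<omega> \<in> space M. X i \<omega> = x i} \<in> sets M" if "i \<le> l" for i
    using measurable_sets[OF X_measurable_UNIV[of i], of "{x i}"] that l
    by (auto simp: vimage_def Int_def conj_commute)
  then have "(\<Inter>i\<in>{..l}. {\<omega> \<in> space M. X i \<omega> = x i}) \<in> sets M"
    by (intro sets.finite_INT) auto
  also have "(\<Inter>i\<in>{..l}. {\<omega> \<in> space M. X i \<omega> = x i}) = {\<omega> \<in> space M. \<forall>i\<le>l. X i \<omega> = x i}"
    by auto
  finally show ?thesis .
qed

lemma X_eq_sets: "l \<le> L \<Longrightarrow> {\<omega> \<in> space M. X l \<omega> = k} \<in> sets M"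
  using measurable_sets[OF X_measurable_UNIV[of l], of "{k}"]
  by (auto simp: vimage_def Int_def conj_commute)

text \<open>A step resamples the state from the equilibrium law with probability \<open>a\<close>
  and keeps it otherwise, so one formula affine in \<open>k\<close> covers both rows of the
  transition matrix. For \<open>k = 1\<close> the chain prescribes the decay probability, and
  complementation gives \<open>1 - a * (1 - g (Suc l))\<close>.\<close>

lemma transition_prob:
  assumes l: "l < L" and pos: "\<P>(\<omega> in M. X l \<omega> = k) > 0"
  shows "\<P>(\<omega> in M. X (Suc l) \<omega> = 1 \<bar> X l \<omega> = k) = a * g (Suc l) + (1 - a) * real k"
proof -
  have st: "\<forall>l\<in>{1..L}.
        (\<P>(\<omega> in M. X (l - 1) \<omega> = 0) > 0 \<longrightarrow> \<P>(\<omega> in M. X l \<omega> = 1 \<bar> X (l - 1) \<omega> = 0) = a * g l) \<and>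
        (\<P>(\<omega> in M. X (l - 1) \<omega> = 1) > 0 \<longrightarrow>
           \<P>(\<omega> in M. X l \<omega> = 0 \<bar> X (l - 1) \<omega> = 1) = a * (1 - g l))"
    using chain by (simp add: thermalization_chain_def a_def g_def)
  have k: "k = 0 \<or> k = 1"
  proof (rule ccontr)
    assume "\<not> ?thesis"
    then have "{\<omega> \<in> space M. X l \<omega> = k} = {}" using X_values[of l] l by fastforce
    then show False using pos by (metis measure_empty less_irrefl)
  qed
  show ?thesis
  proof (cases "k = 0")
    case True
    then show ?thesis using bspec[OF st, of "Suc l"] l pos by auto
  next
    case False
    then have k1: "k = 1" using k by simp
    let ?B = "{\<omega> \<in> space M. X l \<omega> = 1}"
    let ?C = "\<lambda>j. {\<omega> \<in> space M. X (Suc l) \<omega> = j \<and> X l \<omega> = 1}"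
    have C: "?C j \<in> sets M" for j
    proof -
      have "?C j = {\<omega> \<in> space M. X (Suc l) \<omega> = j} \<inter> ?B" by auto
      then show ?thesis using X_eq_sets[of l 1] X_eq_sets[of "Suc l" j] l by auto
    qed
    have "?B = ?C 0 \<union> ?C 1" using X_values[of "Suc l"] l by auto
    moreover have "prob (?C 0 \<union> ?C 1) = prob (?C 0) + prob (?C 1)"
      by (rule finite_measure_Union[OF C C]) auto
    ultimately have sum: "prob ?B = prob (?C 0) + prob (?C 1)" by simp
    have "prob (?C 0) / prob ?B = a * (1 - g (Suc l))"
      using bspec[OF st, of "Suc l"] l pos k1 by (auto simp: cond_prob_def)
    moreover have "prob (?C 1) / prob ?B = 1 - prob (?C 0) / prob ?B"
      using sum pos k1 by (simp add: field_simps)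
    ultimately show ?thesis using k1 by (simp add: cond_prob_def algebra_simps)
  qed
qed

text \<open>In terms of joint probabilities the transition rule also holds for null histories, where
  both sides are 0; it can therefore be summed over all histories.\<close>

lemma history_step:
  assumes l: "l < L"
  shows "\<P>(\<omega> in M. X (Suc l) \<omega> = 1 \<and> (\<forall>i\<le>l. X i \<omega> = x i))
    = (a * g (Suc l) + (1 - a) * real (x l)) * \<P>(\<omega> in M. \<forall>i\<le>l. X i \<omega> = x i)"
proof (cases "\<P>(\<omega> in M. \<forall>i\<le>l. X i \<omega> = x i) = 0")
  case True
  have "\<P>(\<omega> in M. X (Suc l) \<omega> = 1 \<and> (\<forall>i\<le>l. X i \<omega> = x i)) \<le> \<P>(\<omega> in M. \<forall>i\<le>l. X i \<omega> = x i)"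
    using l by (intro finite_measure_mono history_sets) auto
  then show ?thesis using True by (simp add: measure_le_0_iff)
next
  case False
  then have pos: "\<P>(\<omega> in M. \<forall>i\<le>l. X i \<omega> = x i) > 0"
    by (simp add: zero_less_measure_iff)
  have "\<P>(\<omega> in M. \<forall>i\<le>l. X i \<omega> = x i) \<le> \<P>(\<omega> in M. X l \<omega> = x l)"
    using l by (intro finite_measure_mono X_eq_sets) auto
  then have pos': "\<P>(\<omega> in M. X l \<omega> = x l) > 0" using pos by linarith
  \<comment> \<open>The Markov condition reads the next state off the same function as the history,
    so the history is extended by an excited state.\<close>
  define y where "y = x(Suc l := 1)"
  have y: "y (Suc l) = 1" "\<And>i. i \<le> l \<Longrightarrow> y i = x i" by (auto simp: y_def)
  have "\<P>(\<omega> in M. X (Suc l) \<omega> = y (Suc l) \<bar> \<forall>i\<le>l. X i \<omega> = y i) =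
        \<P>(\<omega> in M. X (Suc l) \<omega> = y (Suc l) \<bar> X l \<omega> = y l)"
  proof -
    have "\<forall>x. \<P>(\<omega> in M. \<forall>i\<le>l. X i \<omega> = x i) > 0 \<longrightarrow>
        \<P>(\<omega> in M. X (Suc l) \<omega> = x (Suc l) \<bar> \<forall>i\<le>l. X i \<omega> = x i) =
        \<P>(\<omega> in M. X (Suc l) \<omega> = x (Suc l) \<bar> X l \<omega> = x l)"
      using chain l unfolding thermalization_chain_def markov_chain_def by blast
    moreover have "\<P>(\<omega> in M. \<forall>i\<le>l. X i \<omega> = y i) > 0" using pos y(2) by simp
    ultimately show ?thesis by blast
  qed
  then have "\<P>(\<omega> in M. X (Suc l) \<omega> = 1 \<bar> \<forall>i\<le>l. X i \<omega> = x i) = a * g (Suc l) + (1 - a) * real (x l)"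
    using transition_prob[OF l pos'] y by simp
  then show ?thesis using pos by (simp add: cond_prob_def field_simps)
qed

text \<open>The hypothesis on \<open>f\<close> says that it depends only on coordinates up to
  \<open>l\<close>. There are finitely many two-valued histories, and exactly one of them agrees
  with the given trajectory.\<close>

lemma history_expansion:
  fixes f :: "(nat \<Rightarrow> nat) \<Rightarrow> real"
  assumes l: "l \<le> L" and f: "\<forall>x y. (\<forall>i\<le>l. x i = y i) \<longrightarrow> f x = f y" and \<omega>: "\<omega> \<in> space M"
  shows "f (\<lambda>i. X i \<omega>) = (\<Sum>x\<in>(\<Pi>\<^sub>E i\<in>{..l}. {0, 1}).
           f x * indicator {\<omega> \<in> space M. \<forall>i\<le>l. X i \<omega> = x i} \<omega>)"
proof -
  \<comment> \<open>Restriction makes the trajectory \<open>undefined\<close> beyond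
    \<open>l\<close>, as membership in the extensional product demands.\<close>
  define z where "z = restrict (\<lambda>i. X i \<omega>) {..l}"
  have z: "z \<in> (\<Pi>\<^sub>E i\<in>{..l}. {0, 1})"
    using X_values[OF _ \<omega>] l by (auto simp: z_def)
  have "(\<Sum>x\<in>(\<Pi>\<^sub>E i\<in>{..l}. {0, 1}). f x * indicator {\<omega> \<in> space M. \<forall>i\<le>l. X i \<omega> = x i} \<omega>)
      = (\<Sum>x\<in>(\<Pi>\<^sub>E i\<in>{..l}. {0, 1}). if x = z then f x else 0)"
  proof (rule sum.cong[OF refl])
    fix x :: "nat \<Rightarrow> nat" assume x: "x \<in> (\<Pi>\<^sub>E i\<in>{..l}. {0, 1})"
    have "(\<forall>i\<le>l. X i \<omega> = x i) \<longleftrightarrow> x = z"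
      using PiE_arb[OF x] by (fastforce simp: z_def)
    then show "f x * indicator {\<omega> \<in> space M. \<forall>i\<le>l. X i \<omega> = x i} \<omega> = (if x = z then f x else 0)"
      using \<omega> by (simp add: indicator_def)
  qed
  also have "\<dots> = f z"
    using z by (simp add: finite_PiE)
  also have "\<dots> = f (\<lambda>i. X i \<omega>)"
    by (rule f[rule_format]) (simp add: z_def)
  finally show ?thesis by simp
qed

lemma history_integrable:
  fixes f :: "(nat \<Rightarrow> nat) \<Rightarrow> real"
  assumes l: "l \<le> L" and f: "\<forall>x y. (\<forall>i\<le>l. x i = y i) \<longrightarrow> f x = f y"
  shows "integrable M (\<lambda>\<omega>. f (\<lambda>i. X i \<omega>))"
proof -
  have "integrable M (\<lambda>\<omega>. \<Sum>x\<in>(\<Pi>\<^sub>E i\<in>{..l}. {0, 1}).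
           f x * indicator {\<omega> \<in> space M. \<forall>i\<le>l. X i \<omega> = x i} \<omega>)"
    by (intro Bochner_Integration.integrable_sum integrable_mult_right integrable_real_indicator
        history_sets l) (simp add: emeasure_eq_measure)
  then show ?thesis
    by (subst Bochner_Integration.integrable_cong[OF refl history_expansion[where f = f, OF l f]])
qed

text \<open>The Markov property in the form
  \<open>E[X (l + 1) | X 0, \<dots>, X l] = a * g (l + 1) + (1 - a) * X l\<close>.\<close>

lemma expectation_step:
  fixes f :: "(nat \<Rightarrow> nat) \<Rightarrow> real"
  assumes l: "l < L" and f: "\<forall>x y. (\<forall>i\<le>l. x i = y i) \<longrightarrow> f x = f y"
  shows "expectation (\<lambda>\<omega>. real (X (Suc l) \<omega>) * f (\<lambda>i. X i \<omega>)) =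
    a * g (Suc l) * expectation (\<lambda>\<omega>. f (\<lambda>i. X i \<omega>))
      + (1 - a) * expectation (\<lambda>\<omega>. real (X l \<omega>) * f (\<lambda>i. X i \<omega>))"
proof -
  let ?H = "\<lambda>x. {\<omega> \<in> space M. \<forall>i\<le>l. X i \<omega> = x i}"
  let ?K = "\<lambda>x. {\<omega> \<in> space M. X (Suc l) \<omega> = 1 \<and> (\<forall>i\<le>l. X i \<omega> = x i)}"
  let ?P = "\<Pi>\<^sub>E i\<in>{..l}. {0::nat, 1}"
  define q where "q x = a * g (Suc l) + (1 - a) * real (x l)" for x :: "nat \<Rightarrow> nat"
  have l': "l \<le> L" using l by simp
  have H: "?H x \<in> sets M" for x using history_sets[OF l'] .
  have K: "?K x \<in> sets M" for x
  proof -
    have "?K x = {\<omega> \<in> space M. X (Suc l) \<omega> = 1} \<inter> ?H x" by auto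
    then show ?thesis using sets.Int[OF X_eq_sets[of "Suc l" 1] H[of x]] l by simp
  qed
  have fq: "\<forall>x y. (\<forall>i\<le>l. x i = y i) \<longrightarrow> f x * q x = f y * q y"
  proof (intro allI impI)
    fix x y :: "nat \<Rightarrow> nat" assume xy: "\<forall>i\<le>l. x i = y i"
    show "f x * q x = f y * q y" using f[rule_format, of x y] xy by (simp add: q_def)
  qed
  have fX: "\<forall>x y. (\<forall>i\<le>l. x i = y i) \<longrightarrow> real (x l) * f x = real (y l) * f y"
  proof (intro allI impI)
    fix x y :: "nat \<Rightarrow> nat" assume xy: "\<forall>i\<le>l. x i = y i"
    show "real (x l) * f x = real (y l) * f y" using f[rule_format, of x y] xy by simp
  qed
  have "expectation (\<lambda>\<omega>. real (X (Suc l) \<omega>) * f (\<lambda>i. X i \<omega>))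
      = expectation (\<lambda>\<omega>. \<Sum>x\<in>?P. f x * indicator (?K x) \<omega>)"
  proof (rule Bochner_Integration.integral_cong[OF refl])
    fix \<omega> assume \<omega>: "\<omega> \<in> space M"
    \<comment> \<open>\<open>X (Suc l)\<close> is 0 or 1, so it cuts the history event down to the
      part followed by an excited state.\<close>
    have "real (X (Suc l) \<omega>) * indicator (?H x) \<omega> = indicator (?K x) \<omega>" for x
      using X_values[of "Suc l" \<omega>] l \<omega> by (auto simp: indicator_def)
    then have "real (X (Suc l) \<omega>) * (f x * indicator (?H x) \<omega>) = f x * indicator (?K x) \<omega>" for x
      by (simp add: mult.left_commute)
    then show "real (X (Suc l) \<omega>) * f (\<lambda>i. X i \<omega>) = (\<Sum>x\<in>?P. f x * indicator (?K x) \<omega>)"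
      unfolding history_expansion[where f = f, OF l' f \<omega>] sum_distrib_left
      by (intro sum.cong refl)
  qed
  also have "\<dots> = (\<Sum>x\<in>?P. f x * prob (?K x))"
    using H K by (intro expectation_sum_indicator[symmetric] expectation_sum_indicator)
  also have "\<dots> = (\<Sum>x\<in>?P. (f x * q x) * prob (?H x))"
    by (simp only: history_step[OF l] q_def mult.assoc)
  \<comment> \<open>The transition factor \<open>q\<close> again depends only on the history up to
    \<open>l\<close>, so the sum folds back into an expectation.\<close>
  also have "\<dots> = expectation (\<lambda>\<omega>. \<Sum>x\<in>?P. (f x * q x) * indicator (?H x) \<omega>)"
    using H K by (intro expectation_sum_indicator[symmetric] expectation_sum_indicator)
  also have "\<dots> = expectation (\<lambda>\<omega>. f (\<lambda>i. X i \<omega>) * q (\<lambda>i. X i \<omega>))"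
    by (rule Bochner_Integration.integral_cong[OF refl],
        rule history_expansion[where f = "\<lambda>x. f x * q x", OF l' fq, symmetric])
  also have "\<dots> = expectation (\<lambda>\<omega>. a * g (Suc l) * f (\<lambda>i. X i \<omega>)
      + (1 - a) * (real (X l \<omega>) * f (\<lambda>i. X i \<omega>)))"
    by (simp add: q_def algebra_simps)
  also have "\<dots> = a * g (Suc l) * expectation (\<lambda>\<omega>. f (\<lambda>i. X i \<omega>))
      + (1 - a) * expectation (\<lambda>\<omega>. real (X l \<omega>) * f (\<lambda>i. X i \<omega>))"
  proof -
    have "integrable M (\<lambda>\<omega>. f (\<lambda>i. X i \<omega>))"
      by (rule history_integrable[where f = f, OF l' f])
    moreover have "integrable M (\<lambda>\<omega>. real (X l \<omega>) * f (\<lambda>i. X i \<omega>))"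
      by (rule history_integrable[where f = "\<lambda>x. real (x l) * f x", OF l' fX])
    ultimately show ?thesis by simp
  qed
  finally show ?thesis .
qed


section \<open>Decay of correlations\<close>

definition mean :: "nat \<Rightarrow> real" where "mean l = expectation (\<lambda>\<omega>. real (X l \<omega>))"

lemma X_integrable: "l \<le> L \<Longrightarrow> integrable M (\<lambda>\<omega>. real (X l \<omega>))"
  by (rule history_integrable[where f = "\<lambda>x. real (x l)"]) auto

lemma mean_bounds:
  assumes "l \<le> L"
  shows "0 \<le> mean l" "mean l \<le> 1"
proof -
  show "0 \<le> mean l" by (simp add: mean_def)
  have "mean l \<le> expectation (\<lambda>\<omega>. 1)"
    unfolding mean_def using X_values assms
    by (intro integral_mono X_integrable) fastforce+
  then show "mean l \<le> 1" by (simp add: prob_space)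
qed

lemma mean_0: "mean 0 = p0"
proof -
  have "mean 0 = expectation (indicator {\<omega> \<in> space M. X 0 \<omega> = 1})"
    unfolding mean_def using X_values[of 0]
    by (intro Bochner_Integration.integral_cong) (fastforce simp: indicator_def)+
  also have "\<dots> = p0"
    using X_eq_sets[of 0 1] chain by (simp add: thermalization_chain_def)
  finally show ?thesis .
qed

text \<open>The sum stops before \<open>l\<close>, so that its product with \<open>X l\<close> obeys
  a recursion through the Markov step. At \<open>l = L\<close> it is the centered work up to the
  factor \<open>\<epsilon> / L\<close>.\<close>

definition centered_sum :: "nat \<Rightarrow> 'a \<Rightarrow> real" where
  "centered_sum l \<omega> = (\<Sum>i<l. real (X i \<omega>) - mean i)"

lemma centered_sum_integrable:
  assumes "l < L"
  shows "integrable M (centered_sum (Suc l))"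
    "integrable M (\<lambda>\<omega>. real (X l \<omega>) * centered_sum (Suc l) \<omega>)"
    "integrable M (centered_sum l)"
    "integrable M (\<lambda>\<omega>. real (X l \<omega>) * centered_sum l \<omega>)"
    "integrable M (\<lambda>\<omega>. (centered_sum l \<omega>)\<^sup>2)"
  unfolding centered_sum_def using assms
  by (auto intro!: history_integrable[where f = "\<lambda>x. \<Sum>i<Suc l. real (x i) - mean i" and l = l]
      history_integrable[where f = "\<lambda>x. real (x l) * (\<Sum>i<Suc l. real (x i) - mean i)" and l = l]
      history_integrable[where f = "\<lambda>x. \<Sum>i<l. real (x i) - mean i" and l = l]
      history_integrable[where f = "\<lambda>x. real (x l) * (\<Sum>i<l. real (x i) - mean i)" and l = l]
      history_integrable[where f = "\<lambda>x. (\<Sum>i<l. real (x i) - mean i)\<^sup>2" and l = l]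
      arg_cong2[where f = "(*)"] arg_cong[where f = "\<lambda>x. x\<^sup>2"] sum.cong
      simp del: sum.lessThan_Suc)

lemma expectation_centered_sum: "l \<le> L \<Longrightarrow> expectation (centered_sum l) = 0"
  unfolding centered_sum_def
  by (subst Bochner_Integration.integral_sum) (auto simp: X_integrable mean_def prob_space)

text \<open>If \<open>c l\<close> is the left side, one Markov step gives
  \<open>c (l + 1) = (1 - a) * (c l + Var (X l))\<close> with variance at most 1. The bound
  \<open>1 / a\<close>, a geometric series of ratio \<open>1 - a\<close>, is preserved because
  \<open>(1 - a) * (1 / a + 1) = 1 / a - a\<close>.\<close>

lemma expectation_centered_sum_le:
  assumes "l < L"
  shows "expectation (\<lambda>\<omega>. real (X l \<omega>) * centered_sum l \<omega>) \<le> 1 / a"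
  using assms
proof (induction l)
  case 0
  then show ?case using a_bounds by (simp add: centered_sum_def)
next
  case (Suc l)
  then have l: "l < L" by simp
  have sq: "integrable M (\<lambda>\<omega>. real (X l \<omega>) * (real (X l \<omega>) - mean l))"
    by (rule history_integrable[where f = "\<lambda>x. real (x l) * (real (x l) - mean l)" and l = l])
      (use l in auto)
  have "expectation (\<lambda>\<omega>. real (X l \<omega>) * (real (X l \<omega>) - mean l)) \<le> expectation (\<lambda>\<omega>. 1)"
  proof (rule integral_mono[OF sq])
    fix \<omega> assume "\<omega> \<in> space M"
    then show "real (X l \<omega>) * (real (X l \<omega>) - mean l) \<le> 1"
      using X_values[of l \<omega>] mean_bounds[of l] l by auto
  qed simp
  then have v: "expectation (\<lambda>\<omega>. real (X l \<omega>) * (real (X l \<omega>) - mean l)) \<le> 1"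
    by (simp add: prob_space)
  have "expectation (\<lambda>\<omega>. real (X (Suc l) \<omega>) * centered_sum (Suc l) \<omega>)
      = a * g (Suc l) * expectation (centered_sum (Suc l))
        + (1 - a) * expectation (\<lambda>\<omega>. real (X l \<omega>) * centered_sum (Suc l) \<omega>)"
    unfolding centered_sum_def
    by (rule expectation_step[OF l, where f = "\<lambda>x. \<Sum>i<Suc l. real (x i) - mean i"])
      (auto intro!: sum.cong simp del: sum.lessThan_Suc)
  \<comment> \<open>The drive \<open>g\<close> enters only as a multiple of the mean of the centered
    sum, which is zero.\<close>
  also have "\<dots> = (1 - a) * expectation (\<lambda>\<omega>. real (X l \<omega>) * centered_sum (Suc l) \<omega>)"
    using expectation_centered_sum[of "Suc l"] l by simp
  also have "(\<lambda>\<omega>. real (X l \<omega>) * centered_sum (Suc l) \<omega>) =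
      (\<lambda>\<omega>. real (X l \<omega>) * centered_sum l \<omega> + real (X l \<omega>) * (real (X l \<omega>) - mean l))"
    by (simp add: centered_sum_def algebra_simps)
  also have "expectation \<dots> = expectation (\<lambda>\<omega>. real (X l \<omega>) * centered_sum l \<omega>)
      + expectation (\<lambda>\<omega>. real (X l \<omega>) * (real (X l \<omega>) - mean l))"
    by (rule Bochner_Integration.integral_add[OF centered_sum_integrable(4)[OF l] sq])
  also have "(1 - a) * \<dots> \<le> (1 - a) * (1 / a + 1)"
    using Suc.IH[OF l] v a_bounds by (intro mult_left_mono add_mono) auto
  also have "\<dots> \<le> 1 / a"
    using a_bounds by (simp add: field_simps)
  finally show ?case .
qed

text \<open>Each new term contributes twice its covariance with the past, at most
  \<open>2 / a\<close>, plus its own variance, at most 1. Growth linear in \<open>l\<close> instead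
  of quadratic is what suppresses fluctuations under slow driving.\<close>

lemma expectation_centered_sum_square_le:
  assumes "l \<le> L"
  shows "expectation (\<lambda>\<omega>. (centered_sum l \<omega>)\<^sup>2) \<le> real l * (2 / a + 1)"
  using assms
proof (induction l)
  case 0
  then show ?case by (simp add: centered_sum_def)
next
  case (Suc l)
  then have l: "l < L" by simp
  note int = centered_sum_integrable[OF l]
  have sq: "integrable M (\<lambda>\<omega>. (real (X l \<omega>) - mean l)\<^sup>2)"
    by (rule history_integrable[where f = "\<lambda>x. (real (x l) - mean l)\<^sup>2" and l = l])
      (use l in auto)
  have "expectation (\<lambda>\<omega>. (real (X l \<omega>) - mean l)\<^sup>2) \<le> expectation (\<lambda>\<omega>. 1)"
  proof (rule integral_mono[OF sq])
    fix \<omega> assume "\<omega> \<in> space M"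
    then show "(real (X l \<omega>) - mean l)\<^sup>2 \<le> 1"
      using X_values[of l \<omega>] mean_bounds[of l] l by (auto simp: abs_square_le_1)
  qed simp
  then have v: "expectation (\<lambda>\<omega>. (real (X l \<omega>) - mean l)\<^sup>2) \<le> 1"
    by (simp add: prob_space)
  \<comment> \<open>The cross term is expanded with \<open>X l\<close> uncentered, to match
    \<open>expectation_centered_sum_le\<close>; what remains is a multiple of the centered sum and
    has mean zero.\<close>
  have "(\<lambda>\<omega>. (centered_sum (Suc l) \<omega>)\<^sup>2) = (\<lambda>\<omega>. (centered_sum l \<omega>)\<^sup>2
      + 2 * (real (X l \<omega>) * centered_sum l \<omega>) - 2 * mean l * centered_sum l \<omega>
      + (real (X l \<omega>) - mean l)\<^sup>2)"
    by (simp add: centered_sum_def power2_eq_square algebra_simps)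
  then have "expectation (\<lambda>\<omega>. (centered_sum (Suc l) \<omega>)\<^sup>2)
      = expectation (\<lambda>\<omega>. (centered_sum l \<omega>)\<^sup>2)
        + 2 * expectation (\<lambda>\<omega>. real (X l \<omega>) * centered_sum l \<omega>)
        - 2 * mean l * expectation (centered_sum l) + expectation (\<lambda>\<omega>. (real (X l \<omega>) - mean l)\<^sup>2)"
    using int sq by simp
  also have "\<dots> \<le> real l * (2 / a + 1) + 2 * (1 / a) + 1"
    using Suc.IH l v expectation_centered_sum_le[OF l] expectation_centered_sum[of l] by simp
  also have "\<dots> = real (Suc l) * (2 / a + 1)"
    by (simp add: algebra_simps add_divide_distrib)
  finally show ?case .
qed

section \<open>Probabilities of constant trajectories\<close>

lemma expectation_ground_path:
  assumes "l \<le> L"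
  shows "expectation (\<lambda>\<omega>. \<Prod>i<Suc l. 1 - real (X i \<omega>)) = (1 - p0) * (\<Prod>i<l. 1 - a * g (Suc i))"
  using assms
proof (induction l)
  case 0
  have "expectation (\<lambda>\<omega>. 1 - real (X 0 \<omega>)) = 1 - mean 0"
    by (subst Bochner_Integration.integral_diff) (auto simp: X_integrable mean_def prob_space)
  then show ?case by (simp add: mean_0)
next
  case (Suc l)
  then have l: "l < L" by simp
  let ?f = "\<lambda>x. \<Prod>i<Suc l. 1 - real (x i)"
  have dep: "\<forall>x y. (\<forall>i\<le>l. x i = y i) \<longrightarrow> ?f x = ?f y"
    by (auto intro!: prod.cong simp del: prod.lessThan_Suc)
  have int: "integrable M (\<lambda>\<omega>. ?f (\<lambda>i. X i \<omega>))"
    by (rule history_integrable[where f = ?f and l = l]) (use l dep in auto)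
  have int': "integrable M (\<lambda>\<omega>. real (X (Suc l) \<omega>) * ?f (\<lambda>i. X i \<omega>))"
    by (rule history_integrable[where f = "\<lambda>x. real (x (Suc l)) * ?f x" and l = "Suc l"])
      (use l in \<open>auto intro!: arg_cong2[where f = "(*)"] prod.cong simp del: prod.lessThan_Suc\<close>)
  \<comment> \<open>\<open>?f\<close> indicates the ground state up to \<open>l\<close>, where
    \<open>X l = 0\<close>. Only the resampling term of the Markov step survives, and the next
    factor is \<open>1 - a * g (Suc l)\<close>.\<close>
  have "expectation (\<lambda>\<omega>. real (X l \<omega>) * ?f (\<lambda>i. X i \<omega>)) = expectation (\<lambda>\<omega>. 0)"
    using X_values[of l] l by (intro Bochner_Integration.integral_cong) fastforce+
  then have "expectation (\<lambda>\<omega>. real (X (Suc l) \<omega>) * ?f (\<lambda>i. X i \<omega>))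
      = a * g (Suc l) * expectation (\<lambda>\<omega>. ?f (\<lambda>i. X i \<omega>))"
    using expectation_step[where f = ?f, OF l dep] by simp
  moreover have "(\<lambda>\<omega>. \<Prod>i<Suc (Suc l). 1 - real (X i \<omega>))
      = (\<lambda>\<omega>. ?f (\<lambda>i. X i \<omega>) - real (X (Suc l) \<omega>) * ?f (\<lambda>i. X i \<omega>))"
    by (simp add: algebra_simps)
  ultimately have "expectation (\<lambda>\<omega>. \<Prod>i<Suc (Suc l). 1 - real (X i \<omega>))
      = expectation (\<lambda>\<omega>. ?f (\<lambda>i. X i \<omega>)) - a * g (Suc l) * expectation (\<lambda>\<omega>. ?f (\<lambda>i. X i \<omega>))"
    by (simp only: Bochner_Integration.integral_diff[OF int int'])
  also have "expectation (\<lambda>\<omega>. ?f (\<lambda>i. X i \<omega>)) = (1 - p0) * (\<Prod>i<l. 1 - a * g (Suc i))"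
    using Suc.IH l by (simp only: less_imp_le)
  finally show ?case by (simp add: algebra_simps)
qed

text \<open>The product indicates excitation at times \<open>0\<close> to \<open>l\<close>, which
  span \<open>l\<close> transitions. On this event \<open>X l = 1\<close>, so a Markov step
  multiplies by \<open>a * g (Suc l) + (1 - a) = 1 - a * (1 - g (Suc l))\<close>.\<close>

lemma expectation_excited_path:
  assumes "l \<le> L"
  shows "expectation (\<lambda>\<omega>. \<Prod>i<Suc l. real (X i \<omega>)) = p0 * (\<Prod>i<l. 1 - a * (1 - g (Suc i)))"
  using assms
proof (induction l)
  case 0
  then show ?case using mean_0 by (simp add: mean_def)
next
  case (Suc l)
  then have l: "l < L" by simp
  let ?f = "\<lambda>x. \<Prod>i<Suc l. real (x i)"
  have dep: "\<forall>x y. (\<forall>i\<le>l. x i = y i) \<longrightarrow> ?f x = ?f y"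
    by (auto intro!: prod.cong simp del: prod.lessThan_Suc)
  have "expectation (\<lambda>\<omega>. real (X l \<omega>) * ?f (\<lambda>i. X i \<omega>)) = expectation (\<lambda>\<omega>. ?f (\<lambda>i. X i \<omega>))"
    using X_values[of l] l by (intro Bochner_Integration.integral_cong) fastforce+
  then have "expectation (\<lambda>\<omega>. real (X (Suc l) \<omega>) * ?f (\<lambda>i. X i \<omega>))
      = (1 - a * (1 - g (Suc l))) * expectation (\<lambda>\<omega>. ?f (\<lambda>i. X i \<omega>))"
    using expectation_step[where f = ?f, OF l dep] by (simp add: algebra_simps)
  moreover have "(\<lambda>\<omega>. \<Prod>i<Suc (Suc l). real (X i \<omega>)) = (\<lambda>\<omega>. real (X (Suc l) \<omega>) * ?f (\<lambda>i. X i \<omega>))"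
    by (simp add: algebra_simps)
  moreover have "expectation (\<lambda>\<omega>. ?f (\<lambda>i. X i \<omega>)) = p0 * (\<Prod>i<l. 1 - a * (1 - g (Suc i)))"
    using Suc.IH l by (simp only: less_imp_le)
  ultimately have "expectation (\<lambda>\<omega>. \<Prod>i<Suc (Suc l). real (X i \<omega>))
      = (1 - a * (1 - g (Suc l))) * (p0 * (\<Prod>i<l. 1 - a * (1 - g (Suc i))))"
    by (simp only:)
  then show ?case by simp
qed

end

section \<open>Work of the linearly driven chain\<close>

locale linear_drive = thermal_chain M \<kappa> T p0 \<tau> "linear_gap \<delta>min \<delta>max \<tau>" L X
  for M :: "'a measure" and \<kappa> T p0 \<tau> \<delta>min \<delta>max :: real and L :: nat and X :: "nat \<Rightarrow> 'a \<Rightarrow> nat" +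
  assumes T_pos: "T > 0" and gap_less: "\<delta>min < \<delta>max" and p0_bounds: "0 \<le> p0" "p0 \<le> 1"
begin

abbreviation \<epsilon> :: real where "\<epsilon> \<equiv> \<delta>max - \<delta>min"

abbreviation lnZ :: "real \<Rightarrow> real" where "lnZ d \<equiv> ln (partition_function T d)"

abbreviation work :: "'a \<Rightarrow> real" where "work \<equiv> discrete_work (linear_gap \<delta>min \<delta>max \<tau>) \<tau> L X"

abbreviation A :: real where "A \<equiv> \<kappa> * \<tau> * T / \<epsilon> * (lnZ \<delta>min - lnZ \<delta>max)"

section \<open>Discrete work as an occupation count\<close>

lemma linear_gap_step: "linear_gap \<delta>min \<delta>max \<tau> (x * (\<tau> / real L)) = \<delta>max - \<epsilon> * (x / real L)"
  using tau_pos by (simp add: linear_gap_def)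

text \<open>Every step lowers the gap by the same amount. Step \<open>l\<close> weighs the state
  \<open>X (l - 1)\<close>, so after the index shift the states \<open>X 0\<close> to
  \<open>X (L - 1)\<close> are counted and \<open>X L\<close> is not.\<close>

lemma work_eq: "work \<omega> = \<epsilon> / real L * (\<Sum>i<L. real (X i \<omega>))"
proof -
  have "work \<omega> = (\<Sum>l = 1..L. real (X (l - 1) \<omega>) * (\<epsilon> / real L))"
    unfolding discrete_work_def
  proof (intro sum.cong refl arg_cong2[where f = "(*)"])
    fix l assume "l \<in> {1..L}"
    then obtain k where "l = Suc k" by (cases l) auto
    then show "linear_gap \<delta>min \<delta>max \<tau> (real (l - 1) * (\<tau> / real L))
        - linear_gap \<delta>min \<delta>max \<tau> (real l * (\<tau> / real L)) = \<epsilon> / real L"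
      unfolding linear_gap_step by (simp add: add_divide_distrib distrib_left)
  qed
  also have "\<dots> = (\<Sum>i<L. real (X i \<omega>) * (\<epsilon> / real L))"
    by (rule sum.reindex_bij_witness[of _ Suc "\<lambda>l. l - 1"]) auto
  finally show ?thesis by (simp add: sum_distrib_left mult.commute)
qed

lemma work_measurable: "work \<in> borel_measurable M"
proof -
  have "(\<lambda>\<omega>. \<epsilon> / real L * (\<Sum>i<L. real (X i \<omega>))) \<in> borel_measurable M"
    by (intro borel_measurable_times borel_measurable_const borel_measurable_sum X_measurable_real)
      auto
  then show ?thesis by (simp add: work_eq[abs_def])
qed

lemma work_bounds: "\<omega> \<in> space M \<Longrightarrow> work \<omega> \<in> {0..\<epsilon>}"
proof -
  assume \<omega>: "\<omega> \<in> space M"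
  have "(\<Sum>i<L. real (X i \<omega>)) \<le> (\<Sum>i<L. 1)"
  proof (rule sum_mono)
    fix i assume "i \<in> {..<L}"
    then show "real (X i \<omega>) \<le> 1" using X_values[of i \<omega>] \<omega> by auto
  qed
  then have "\<epsilon> / real L * (\<Sum>i<L. real (X i \<omega>)) \<le> \<epsilon> / real L * real L"
    using gap_less by (intro mult_left_mono) auto
  then show ?thesis
    using gap_less L_pos by (auto simp: work_eq intro!: mult_nonneg_nonneg divide_nonneg_nonneg sum_nonneg)
qed

lemma work_integrable: "integrable M work" "integrable M (\<lambda>\<omega>. (work \<omega>)\<^sup>2)"
proof -
  note work_measurable[measurable]
  show "integrable M work"
    by (rule integrable_const_bound[of _ \<epsilon>]) (use work_bounds in auto)
  show "integrable M (\<lambda>\<omega>. (work \<omega>)\<^sup>2)"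
    by (rule integrable_const_bound[of _ "\<epsilon>\<^sup>2"]) (use work_bounds in \<open>auto intro!: power_mono\<close>)
qed

section \<open>Riemann sums of the excitation probability\<close>

lemma a_eq: "a = \<kappa> * \<tau> / real L"
  by (simp add: a_def)

text \<open>With \<open>u = \<epsilon> / (L * T)\<close>, the gap decrement per step in units of
  \<open>T\<close>, this is the form in which the tangent estimate for \<open>ln Z\<close> applies
  with shift \<open>u\<close>.\<close>

lemma g_eq: "g l = excitation_prob T (\<delta>max - T * (real l * (\<epsilon> / (real L * T))))"
  using T_pos by (simp only: g_def linear_gap_step) (simp add: mult.commute)

text \<open>The gap decreases, so \<open>g\<close> increases with the step and the left endpoint sum
  stays below the integral. This is the tangent estimate for \<open>ln Z\<close> at the start of
  every step, telescoped.\<close>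

lemma sum_g_le: "(\<Sum>i<L. g i) * (\<epsilon> / (real L * T)) \<le> lnZ \<delta>min - lnZ \<delta>max"
proof -
  define u where "u = \<epsilon> / (real L * T)"
  let ?F = "\<lambda>i. lnZ (\<delta>max - T * (real i * u))"
  have "(\<Sum>i<L. g i) * u = (\<Sum>i<L. g i * u)"
    by (rule sum_distrib_right)
  also have "\<dots> \<le> (\<Sum>i<L. ?F (Suc i) - ?F i)"
  proof (rule sum_mono)
    fix i
    have "\<delta>max - T * (real i * u) - T * u = \<delta>max - T * (real (Suc i) * u)"
      by (simp add: algebra_simps)
    then show "g i * u \<le> ?F (Suc i) - ?F i"
      using excitation_prob_le_ln_partition_function[OF T_pos,
          of "\<delta>max - T * (real i * u)" u]
      unfolding g_eq u_def[symmetric] by (simp only:)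
  qed
  also have "\<dots> = ?F L - ?F 0"
    by (rule sum_lessThan_telescope)
  also have "\<dots> = lnZ \<delta>min - lnZ \<delta>max"
    using T_pos L_pos by (simp add: u_def)
  finally show ?thesis unfolding u_def .
qed

text \<open>Here the integrand decreases, so the right endpoint sum is the one below the integral:
  the tangent estimate is used backwards, with shift \<open>- u\<close>. The total length is
  \<open>L * u = \<epsilon> / T\<close>.\<close>

lemma sum_one_minus_g_le:
  "(\<Sum>i<L. 1 - g (Suc i)) * (\<epsilon> / (real L * T)) \<le> \<epsilon> / T - (lnZ \<delta>min - lnZ \<delta>max)"
proof -
  define u where "u = \<epsilon> / (real L * T)"
  let ?F = "\<lambda>i. lnZ (\<delta>max - T * (real i * u))"
  have "(\<Sum>i<L. 1 - g (Suc i)) * u = (\<Sum>i<L. (1 - g (Suc i)) * u)"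
    by (rule sum_distrib_right)
  also have "\<dots> \<le> (\<Sum>i<L. u - (?F (Suc i) - ?F i))"
  proof (rule sum_mono)
    fix i
    have "\<delta>max - T * (real (Suc i) * u) - T * (- u) = \<delta>max - T * (real i * u)"
      by (simp add: algebra_simps)
    then have "g (Suc i) * (- u) \<le> ?F i - ?F (Suc i)"
      using excitation_prob_le_ln_partition_function[OF T_pos,
          of "\<delta>max - T * (real (Suc i) * u)" "- u"]
      unfolding g_eq u_def[symmetric] by (simp only:)
    then show "(1 - g (Suc i)) * u \<le> u - (?F (Suc i) - ?F i)"
      by (simp add: left_diff_distrib)
  qed
  also have "\<dots> = real L * u - (\<Sum>i<L. ?F (Suc i) - ?F i)"
    by (simp add: sum_subtractf)
  also have "(\<Sum>i<L. ?F (Suc i) - ?F i) = ?F L - ?F 0"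
    by (rule sum_lessThan_telescope)
  also have "real L * u - (?F L - ?F 0) = \<epsilon> / T - (lnZ \<delta>min - lnZ \<delta>max)"
    using T_pos L_pos by (simp add: u_def)
  finally show ?thesis unfolding u_def .
qed

section \<open>Constant trajectories of the driven chain\<close>

definition ground_path :: "'a \<Rightarrow> real" where
  "ground_path \<omega> = (\<Prod>i<L. 1 - real (X i \<omega>))"

text \<open>Like \<open>ground_path\<close>, an indicator in product form, to which the exact path
  expectations apply. The range \<open>i < L\<close> covers exactly the states that enter the
  work.\<close>

definition excited_path :: "'a \<Rightarrow> real" where
  "excited_path \<omega> = (\<Prod>i<L. real (X i \<omega>))"

definition ground_prob :: real where "ground_prob = expectation ground_path"

definition excited_prob :: real where "excited_prob = expectation excited_path"

text \<open>\<open>L\<close> states span \<open>L - 1\<close> transitions, each survived with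
  probability \<open>1 - a * g (Suc i)\<close>. The hypothesis gives \<open>a \<le> 1 / 2\<close>
  for the product estimate; the Riemann sum compares the exponent with \<open>A\<close>, at a
  second-order error of order \<open>1 / L\<close>.\<close>

lemma ground_prob_ge:
  assumes "2 * (\<kappa> * \<tau>) \<le> real L"
  shows "(1 - p0) * exp (- A - 2 * (\<kappa> * \<tau>)\<^sup>2 / real L) \<le> ground_prob"
proof -
  obtain n where n: "Suc n = L" using L_pos by (cases L) auto
  then have "n \<le> L" by simp
  have a2: "a \<le> 1 / 2" using assms L_pos by (simp add: a_eq field_simps)
  have "(\<Sum>i<n. a * g (Suc i)) = a * (\<Sum>i<n. g (Suc i))" by (simp add: sum_distrib_left)
  \<comment> \<open>The transitions use \<open>g 1\<close> to \<open>g (L - 1)\<close>; adding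
    \<open>g 0\<close> completes the left endpoint sum.\<close>
  also have "\<dots> \<le> a * (g 0 + (\<Sum>i<n. g (Suc i)))"
    using a_bounds g_bounds[of 0] by simp
  also have "\<dots> = a * (\<Sum>i<L. g i)"
    using sum.lessThan_Suc_shift[of g n] by (simp only: n)
  also have "\<dots> = \<kappa> * \<tau> * T / \<epsilon> * ((\<Sum>i<L. g i) * (\<epsilon> / (real L * T)))"
    using T_pos gap_less by (simp add: a_eq)
  also have "\<dots> \<le> A"
    using sum_g_le T_pos gap_less rate_pos tau_pos by (intro mult_left_mono) auto
  finally have S: "(\<Sum>i<n. a * g (Suc i)) \<le> A" .
  have "2 * real n * a\<^sup>2 \<le> 2 * real L * a\<^sup>2"
    using n by (intro mult_right_mono) auto
  also have "\<dots> = 2 * (\<kappa> * \<tau>)\<^sup>2 / real L"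
    using L_pos by (simp add: a_eq power2_eq_square)
  finally have "exp (- A - 2 * (\<kappa> * \<tau>)\<^sup>2 / real L) \<le> exp (- (\<Sum>i<n. a * g (Suc i)) - 2 * real n * a\<^sup>2)"
    using S by simp
  also have "\<dots> \<le> (\<Prod>i<n. 1 - a * g (Suc i))"
    using a_bounds g_bounds a2
    by (intro prod_one_minus_ge_exp) (auto simp: less_imp_le mult_left_le)
  finally show ?thesis
    using expectation_ground_path[of n] p0_bounds \<open>n \<le> L\<close>
    unfolding ground_prob_def ground_path_def n by (simp add: mult_left_mono)
qed

lemma excited_prob_ge:
  assumes "2 * (\<kappa> * \<tau>) \<le> real L"
  shows "p0 * exp (- (\<kappa> * \<tau> - A) - 2 * (\<kappa> * \<tau>)\<^sup>2 / real L) \<le> excited_prob"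
proof -
  obtain n where n: "Suc n = L" using L_pos by (cases L) auto
  then have "n \<le> L" by simp
  have a2: "a \<le> 1 / 2" using assms L_pos by (simp add: a_eq field_simps)
  have "(\<Sum>i<n. a * (1 - g (Suc i))) = a * (\<Sum>i<n. 1 - g (Suc i))" by (simp add: sum_distrib_left)
  \<comment> \<open>The extra nonnegative term \<open>1 - g L\<close>, from the transition into
    \<open>X L\<close>, completes the right endpoint sum.\<close>
  also have "\<dots> \<le> a * (\<Sum>i<L. 1 - g (Suc i))"
    using a_bounds g_bounds n by (intro mult_left_mono sum_mono2) (auto simp: less_imp_le)
  also have "\<dots> = \<kappa> * \<tau> * T / \<epsilon> * ((\<Sum>i<L. 1 - g (Suc i)) * (\<epsilon> / (real L * T)))"
    using T_pos gap_less by (simp add: a_eq)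
  also have "\<dots> \<le> \<kappa> * \<tau> * T / \<epsilon> * (\<epsilon> / T - (lnZ \<delta>min - lnZ \<delta>max))"
    using sum_one_minus_g_le T_pos gap_less rate_pos tau_pos by (intro mult_left_mono) auto
  also have "\<dots> = \<kappa> * \<tau> - A"
  proof -
    have "\<kappa> * \<tau> * T / \<epsilon> * (\<epsilon> / T) = \<kappa> * \<tau>"
      using T_pos gap_less by simp
    then show ?thesis by (simp only: right_diff_distrib)
  qed
  finally have S: "(\<Sum>i<n. a * (1 - g (Suc i))) \<le> \<kappa> * \<tau> - A" .
  have "2 * real n * a\<^sup>2 \<le> 2 * real L * a\<^sup>2"
    using n by (intro mult_right_mono) auto
  also have "\<dots> = 2 * (\<kappa> * \<tau>)\<^sup>2 / real L"
    using L_pos by (simp add: a_eq power2_eq_square)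
  finally have "exp (- (\<kappa> * \<tau> - A) - 2 * (\<kappa> * \<tau>)\<^sup>2 / real L)
      \<le> exp (- (\<Sum>i<n. a * (1 - g (Suc i))) - 2 * real n * a\<^sup>2)"
    using S by simp
  also have "\<dots> \<le> (\<Prod>i<n. 1 - a * (1 - g (Suc i)))"
    using a_bounds g_bounds a2
    by (intro prod_one_minus_ge_exp) (auto simp: less_imp_le mult_left_le)
  finally show ?thesis
    using expectation_excited_path[of n] p0_bounds \<open>n \<le> L\<close>
    unfolding excited_prob_def excited_path_def n by (simp add: mult_left_mono)
qed

text \<open>The mixed case leaves the work open: both indicators vanish there, and the later
  estimates reduce to \<open>0 \<le> work \<le> \<epsilon>\<close> or to a square being
  nonnegative.\<close>

lemma path_products:
  assumes "\<omega> \<in> space M"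
  obtains "ground_path \<omega> = 1" "excited_path \<omega> = 0" "work \<omega> = 0"
    | "ground_path \<omega> = 0" "excited_path \<omega> = 1" "work \<omega> = \<epsilon>"
    | "ground_path \<omega> = 0" "excited_path \<omega> = 0"
proof -
  consider "\<forall>i<L. X i \<omega> = 0" | "\<forall>i<L. X i \<omega> = 1"
    | "\<exists>i<L. X i \<omega> = 0" "\<exists>i<L. X i \<omega> = 1"
    using X_values[OF _ assms] by (meson less_imp_le)
  then show thesis
  proof cases
    case 1
    then show thesis using L_pos by (intro that(1)) (auto simp: work_eq ground_path_def excited_path_def)
  next
    case 2
    then show thesis using L_pos by (intro that(2)) (auto simp: work_eq ground_path_def excited_path_def)
  next
    case 3
    then show thesis by (intro that(3)) (auto simp: ground_path_def excited_path_def)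
  qed
qed

section \<open>Comparison of the work with constant trajectories\<close>

lemma path_products_integrable:
  "integrable M ground_path" "integrable M excited_path"
  unfolding ground_path_def excited_path_def
  by (rule history_integrable[where f = "\<lambda>x. \<Prod>i<L. 1 - real (x i)" and l = L]
      history_integrable[where f = "\<lambda>x. \<Prod>i<L. real (x i)" and l = L];
      auto intro!: prod.cong)+

text \<open>The estimates with path indicators are equalities on the two constant trajectories and
  have left side 0 on all others. The free \<open>m\<close> later becomes the mean.\<close>

lemma work_pointwise:
  assumes \<omega>: "\<omega> \<in> space M"
  shows "\<epsilon> * excited_path \<omega> \<le> work \<omega>"
    and "\<epsilon> * ground_path \<omega> \<le> \<epsilon> - work \<omega>"
    and "\<epsilon>\<^sup>2 * excited_path \<omega> \<le> (work \<omega>)\<^sup>2"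
    and "(work \<omega>)\<^sup>2 \<le> \<epsilon> * work \<omega>"
    and "ground_path \<omega> * m\<^sup>2 + excited_path \<omega> * (\<epsilon> - m)\<^sup>2 \<le> (work \<omega> - m)\<^sup>2"
proof -
  have w: "0 \<le> work \<omega>" "work \<omega> \<le> \<epsilon>" using work_bounds[OF \<omega>] by auto
  show "(work \<omega>)\<^sup>2 \<le> \<epsilon> * work \<omega>"
    unfolding power2_eq_square using w by (intro mult_right_mono)
  show "\<epsilon> * excited_path \<omega> \<le> work \<omega>"
    by (rule path_products[OF \<omega>]) (use w in simp_all)
  show "\<epsilon> * ground_path \<omega> \<le> \<epsilon> - work \<omega>"
    by (rule path_products[OF \<omega>]) (use w in simp_all)
  show "\<epsilon>\<^sup>2 * excited_path \<omega> \<le> (work \<omega>)\<^sup>2"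
    by (rule path_products[OF \<omega>]) (use w in simp_all)
  show "ground_path \<omega> * m\<^sup>2 + excited_path \<omega> * (\<epsilon> - m)\<^sup>2 \<le> (work \<omega> - m)\<^sup>2"
    by (rule path_products[OF \<omega>]) (use w in simp_all)
qed

text \<open>When the constant trajectories carry almost all the probability, these inequalities pin
  down mean and second moment, which gives the limit of fast driving.\<close>

lemma work_moments:
  "\<epsilon> * excited_prob \<le> expectation work"
  "\<epsilon> * ground_prob \<le> \<epsilon> - expectation work"
  "\<epsilon>\<^sup>2 * excited_prob \<le> expectation (\<lambda>\<omega>. (work \<omega>)\<^sup>2)"
  "expectation (\<lambda>\<omega>. (work \<omega>)\<^sup>2) \<le> \<epsilon> * expectation work"
proof -
  note int = path_products_integrable work_integrable
  have "expectation (\<lambda>\<omega>. \<epsilon> * excited_path \<omega>) \<le> expectation work"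
    by (intro integral_mono integrable_mult_right int work_pointwise)
  then show "\<epsilon> * excited_prob \<le> expectation work"
    by (simp add: excited_prob_def)
  have "expectation (\<lambda>\<omega>. \<epsilon> * ground_path \<omega>) \<le> expectation (\<lambda>\<omega>. \<epsilon> - work \<omega>)"
    by (intro integral_mono integrable_mult_right Bochner_Integration.integrable_diff
        integrable_const int work_pointwise)
  also have "expectation (\<lambda>\<omega>. \<epsilon> - work \<omega>) = \<epsilon> - expectation work"
    by (subst Bochner_Integration.integral_diff) (auto simp: int prob_space)
  finally show "\<epsilon> * ground_prob \<le> \<epsilon> - expectation work"
    by (simp add: ground_prob_def)
  have "expectation (\<lambda>\<omega>. \<epsilon>\<^sup>2 * excited_path \<omega>) \<le> expectation (\<lambda>\<omega>. (work \<omega>)\<^sup>2)"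
    by (intro integral_mono integrable_mult_right int work_pointwise)
  then show "\<epsilon>\<^sup>2 * excited_prob \<le> expectation (\<lambda>\<omega>. (work \<omega>)\<^sup>2)"
    by (simp add: excited_prob_def)
  have "expectation (\<lambda>\<omega>. (work \<omega>)\<^sup>2) \<le> expectation (\<lambda>\<omega>. \<epsilon> * work \<omega>)"
    by (rule integral_mono[OF int(4) integrable_mult_right[OF int(3)] work_pointwise(4)])
  then show "expectation (\<lambda>\<omega>. (work \<omega>)\<^sup>2) \<le> \<epsilon> * expectation work"
    by simp
qed

lemma work_variance_ge:
  "ground_prob * (expectation work)\<^sup>2 + excited_prob * (\<epsilon> - expectation work)\<^sup>2 \<le> variance work"
proof -
  note int = path_products_integrable work_integrable
  define m where "m = expectation work"
  have "integrable M (\<lambda>\<omega>. (work \<omega>)\<^sup>2 - 2 * m * work \<omega> + m\<^sup>2)"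
    by (intro Bochner_Integration.integrable_add Bochner_Integration.integrable_diff
        integrable_mult_right integrable_const int)
  also have "(\<lambda>\<omega>. (work \<omega>)\<^sup>2 - 2 * m * work \<omega> + m\<^sup>2) = (\<lambda>\<omega>. (work \<omega> - m)\<^sup>2)"
    by (simp add: power2_diff algebra_simps)
  finally have "expectation (\<lambda>\<omega>. ground_path \<omega> * m\<^sup>2 + excited_path \<omega> * (\<epsilon> - m)\<^sup>2)
      \<le> expectation (\<lambda>\<omega>. (work \<omega> - m)\<^sup>2)"
    by (intro integral_mono Bochner_Integration.integrable_add integrable_mult_left int
        work_pointwise)
  also have "expectation (\<lambda>\<omega>. ground_path \<omega> * m\<^sup>2 + excited_path \<omega> * (\<epsilon> - m)\<^sup>2)
      = ground_prob * m\<^sup>2 + excited_prob * (\<epsilon> - m)\<^sup>2"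
    by (subst Bochner_Integration.integral_add) (auto simp: int ground_prob_def excited_prob_def)
  finally show ?thesis by (simp add: m_def)
qed

text \<open>The centered work is \<open>\<epsilon> / L\<close> times \<open>centered_sum L\<close>,
  whose second moment is at most \<open>L * (2 / a + 1)\<close>. Dividing by the square of
  \<open>L\<close> leaves \<open>2 / (a * L) = 2 / (\<kappa> * \<tau>)\<close> and a discretization
  term.\<close>

lemma work_variance_le: "variance work \<le> \<epsilon>\<^sup>2 * (2 / (\<kappa> * \<tau>) + 1 / real L)"
proof -
  have "expectation work = expectation (\<lambda>\<omega>. \<epsilon> / real L * (\<Sum>i<L. real (X i \<omega>)))"
    by (intro Bochner_Integration.integral_cong refl work_eq)
  also have "\<dots> = \<epsilon> / real L * (\<Sum>i<L. mean i)"
    unfolding mean_def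
    by (subst integral_mult_right_zero, subst Bochner_Integration.integral_sum)
      (auto simp: X_integrable)
  finally have m: "expectation work = \<epsilon> / real L * (\<Sum>i<L. mean i)" .
  have "(work \<omega> - expectation work)\<^sup>2 = (\<epsilon> / real L)\<^sup>2 * (centered_sum L \<omega>)\<^sup>2" for \<omega>
    unfolding m work_eq centered_sum_def sum_subtractf power_mult_distrib[symmetric]
      right_diff_distrib ..
  then have "variance work = (\<epsilon> / real L)\<^sup>2 * expectation (\<lambda>\<omega>. (centered_sum L \<omega>)\<^sup>2)"
    by (simp only: integral_mult_right_zero)
  also have "\<dots> \<le> (\<epsilon> / real L)\<^sup>2 * (real L * (2 / a + 1))"
    by (intro mult_left_mono expectation_centered_sum_square_le) auto
  also have "\<dots> = \<epsilon>\<^sup>2 * ((2 / a + 1) / real L)"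
    using L_pos by (simp add: power2_eq_square)
  also have "(2 / a + 1) / real L = 2 / (\<kappa> * \<tau>) + 1 / real L"
    using L_pos by (simp add: a_eq add_divide_distrib)
  finally show ?thesis .
qed

end

section \<open>Work of the continuous process\<close>

text \<open>The discrete works satisfy these estimates up to errors vanishing with the number of
  steps, and their mean and second moment converge; the limit of the latter is
  \<open>v + \<mu>\<^sup>2\<close>. The first four serve the fast limit, the fifth is the variance
  bound, and the last serves the slow limit.\<close>

lemma continuous_work_bounds:
  fixes \<kappa> T \<delta>min \<delta>max p0 \<tau> :: real and W :: "'a \<Rightarrow> real"
  assumes "\<kappa> > 0" "T > 0" "\<delta>min < \<delta>max" "0 \<le> p0" "p0 \<le> 1" "\<tau> > 0"
    and cont: "continuous_process_work \<kappa> T p0 (linear_gap \<delta>min \<delta>max \<tau>) \<tau> M X W"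
  defines "\<epsilon> \<equiv> \<delta>max - \<delta>min"
    and "\<mu> \<equiv> prob_space.expectation M W"
    and "v \<equiv> prob_space.variance M W"
    and "A \<equiv> \<kappa> * \<tau> * T / (\<delta>max - \<delta>min) *
          (ln (partition_function T \<delta>min) - ln (partition_function T \<delta>max))"
  shows "\<epsilon> * (p0 * exp (- (\<kappa> * \<tau> - A))) \<le> \<mu>"
    and "\<epsilon> * ((1 - p0) * exp (- A)) \<le> \<epsilon> - \<mu>"
    and "\<epsilon>\<^sup>2 * (p0 * exp (- (\<kappa> * \<tau> - A))) \<le> v + \<mu>\<^sup>2"
    and "v + \<mu>\<^sup>2 \<le> \<epsilon> * \<mu>"
    and "(1 - p0) * exp (- A) * \<mu>\<^sup>2 + p0 * exp (- (\<kappa> * \<tau> - A)) * (\<epsilon> - \<mu>)\<^sup>2 \<le> v"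
    and "v \<le> \<epsilon>\<^sup>2 * (2 / (\<kappa> * \<tau>))"
proof -
  interpret prob_space M using cont by (simp add: continuous_process_work_def)
  define Y where "Y n = discrete_work (linear_gap \<delta>min \<delta>max \<tau>) \<tau> n (X n)" for n
  \<comment> \<open>From \<open>N\<close> on the chain has enough steps to be defined, and the
    survival estimates, which ask for twice as many, apply as well.\<close>
  define N where "N = nat \<lceil>2 * (\<kappa> * \<tau>)\<rceil>"
  have "\<kappa> * \<tau> > 0" using assms by simp
  have N: "2 * (\<kappa> * \<tau>) \<le> real n" if "n \<ge> N" for n
    using that unfolding N_def by linarith
  have chain: "linear_drive M \<kappa> T p0 \<tau> \<delta>min \<delta>max n (X n)" if "n \<ge> N" for n
  proof -
    have n: "\<kappa> * \<tau> \<le> real n" using N[OF that] \<open>\<kappa> * \<tau> > 0\<close> by simp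
    then have "thermalization_chain \<kappa> T p0 (linear_gap \<delta>min \<delta>max \<tau>) \<tau> n M (X n)"
      using cont by (simp add: continuous_process_work_def)
    then show ?thesis using assms n by unfold_locales auto
  qed
  have Ymeas: "Y n \<in> borel_measurable M" if "n \<ge> N" for n
    using linear_drive.work_measurable[OF chain[OF that]] by (simp add: Y_def[abs_def])
  have Ybd: "Y n \<omega> \<in> {0..\<epsilon>}" if "n \<ge> N" "\<omega> \<in> space M" for n \<omega>
    using linear_drive.work_bounds[OF chain[OF that(1)] that(2)] by (simp add: Y_def \<epsilon>_def)
  have Wmeas[measurable]: "W \<in> borel_measurable M"
    using cont by (simp add: continuous_process_work_def)
  have conv: "converges_in_probability M Y W"
    using cont by (simp add: continuous_process_work_def Y_def[abs_def])
  have AEW: "AE \<omega> in M. W \<omega> \<in> {0..\<epsilon>}"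
    by (rule converges_in_probability_AE_bounded[OF Ymeas Ybd Wmeas conv])
  have intW: "integrable M W"
  proof (rule integrable_const_bound)
    show "AE \<omega> in M. norm (W \<omega>) \<le> \<epsilon>" using AEW by eventually_elim auto
  qed measurable
  have intW2: "integrable M (\<lambda>\<omega>. (W \<omega>)\<^sup>2)"
  proof (rule integrable_const_bound)
    show "AE \<omega> in M. norm ((W \<omega>)\<^sup>2) \<le> \<epsilon>\<^sup>2"
      using AEW by eventually_elim (auto intro!: power_mono)
  qed measurable
  have v: "v = expectation (\<lambda>\<omega>. (W \<omega>)\<^sup>2) - \<mu>\<^sup>2"
    unfolding v_def \<mu>_def by (rule variance_eq[OF intW intW2])
  have "1-lipschitz_on {0..\<epsilon>} (\<lambda>x. x)"
    by (rule lipschitz_onI) auto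
  then have lim1: "(\<lambda>n. expectation (Y n)) \<longlonglongrightarrow> \<mu>"
    unfolding \<mu>_def
    by (intro bounded_convergence_in_probability[where h = "\<lambda>x. x", OF Ymeas Ybd Wmeas conv]) auto
  have "(2 * \<epsilon>)-lipschitz_on {0..\<epsilon>} (\<lambda>x. x\<^sup>2)"
  proof (rule lipschitz_onI)
    fix x y assume xy: "x \<in> {0..\<epsilon>}" "y \<in> {0..\<epsilon>}"
    have "\<bar>x\<^sup>2 - y\<^sup>2\<bar> = \<bar>x + y\<bar> * \<bar>x - y\<bar>"
      by (simp add: abs_mult[symmetric] power2_eq_square algebra_simps)
    also have "\<dots> \<le> 2 * \<epsilon> * \<bar>x - y\<bar>"
      using xy by (intro mult_right_mono) auto
    finally show "dist (x\<^sup>2) (y\<^sup>2) \<le> 2 * \<epsilon> * dist x y"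
      by (simp add: dist_real_def)
  qed (use assms in simp)
  then have lim2: "(\<lambda>n. expectation (\<lambda>\<omega>. (Y n \<omega>)\<^sup>2)) \<longlonglongrightarrow> v + \<mu>\<^sup>2"
    unfolding v diff_add_cancel
    by (intro bounded_convergence_in_probability[where h = "\<lambda>x. x\<^sup>2", OF Ymeas Ybd Wmeas conv]) auto
  have var_Y: "variance (Y n) = expectation (\<lambda>\<omega>. (Y n \<omega>)\<^sup>2) - (expectation (Y n))\<^sup>2" if "n \<ge> N" for n
    using linear_drive.work_integrable[OF chain[OF that]]
    unfolding Y_def[symmetric] by (intro variance_eq)
  have "(\<lambda>n. expectation (\<lambda>\<omega>. (Y n \<omega>)\<^sup>2) - (expectation (Y n))\<^sup>2) \<longlonglongrightarrow> v + \<mu>\<^sup>2 - \<mu>\<^sup>2"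
    by (intro tendsto_intros lim1 lim2)
  then have lim_var: "(\<lambda>n. variance (Y n)) \<longlonglongrightarrow> v"
    using Lim_transform_eventually[of _ v sequentially "\<lambda>n. variance (Y n)"]
      eventually_sequentiallyI[of N, OF var_Y[symmetric]] by force

  \<comment> \<open>\<open>G\<close> and \<open>E\<close> are the survival bounds for
    \<open>n\<close> steps with their discretization error, which disappears in the limit.\<close>
  define G where "G n = (1 - p0) * exp (- A - 2 * (\<kappa> * \<tau>)\<^sup>2 / real n)" for n :: nat
  define E where "E n = p0 * exp (- (\<kappa> * \<tau> - A) - 2 * (\<kappa> * \<tau>)\<^sup>2 / real n)" for n :: nat
  have "G \<longlonglongrightarrow> (1 - p0) * exp (- A - 0)" "E \<longlonglongrightarrow> p0 * exp (- (\<kappa> * \<tau> - A) - 0)"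
    unfolding G_def E_def
    by (intro tendsto_intros tendsto_divide_0[OF tendsto_const]
        filterlim_at_top_imp_at_infinity filterlim_real_sequentially)+
  then have limG: "G \<longlonglongrightarrow> (1 - p0) * exp (- A)" and limE: "E \<longlonglongrightarrow> p0 * exp (- (\<kappa> * \<tau> - A))"
    by simp_all
  have est: "\<epsilon> * E n \<le> expectation (Y n)" "\<epsilon> * G n \<le> \<epsilon> - expectation (Y n)"
    "\<epsilon>\<^sup>2 * E n \<le> expectation (\<lambda>\<omega>. (Y n \<omega>)\<^sup>2)"
    "expectation (\<lambda>\<omega>. (Y n \<omega>)\<^sup>2) \<le> \<epsilon> * expectation (Y n)"
    "G n * (expectation (Y n))\<^sup>2 + E n * (\<epsilon> - expectation (Y n))\<^sup>2 \<le> variance (Y n)"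
    "variance (Y n) \<le> \<epsilon>\<^sup>2 * (2 / (\<kappa> * \<tau>) + 1 / real n)" if n: "n \<ge> N" for n
  proof -
    interpret linear_drive M \<kappa> T p0 \<tau> \<delta>min \<delta>max n "X n" by (rule chain[OF n])
    have G: "G n \<le> ground_prob"
      using ground_prob_ge[OF N[OF n]] by (simp only: G_def A_def)
    have E: "E n \<le> excited_prob"
      using excited_prob_ge[OF N[OF n]] by (simp only: E_def A_def)
    have "\<epsilon> > 0" using assms by simp
    note moments = work_moments[folded Y_def \<epsilon>_def]
    show "\<epsilon> * E n \<le> expectation (Y n)"
      using mult_left_mono[OF E, of \<epsilon>] moments(1) \<open>\<epsilon> > 0\<close> by linarith
    show "\<epsilon> * G n \<le> \<epsilon> - expectation (Y n)"
      using mult_left_mono[OF G, of \<epsilon>] moments(2) \<open>\<epsilon> > 0\<close> by linarith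
    show "\<epsilon>\<^sup>2 * E n \<le> expectation (\<lambda>\<omega>. (Y n \<omega>)\<^sup>2)"
      using mult_left_mono[OF E, of "\<epsilon>\<^sup>2"] moments(3) by simp
    show "expectation (\<lambda>\<omega>. (Y n \<omega>)\<^sup>2) \<le> \<epsilon> * expectation (Y n)"
      by (rule moments(4))
    have "G n * (expectation (Y n))\<^sup>2 + E n * (\<epsilon> - expectation (Y n))\<^sup>2
        \<le> ground_prob * (expectation (Y n))\<^sup>2 + excited_prob * (\<epsilon> - expectation (Y n))\<^sup>2"
      using G E by (intro add_mono mult_right_mono) auto
    then show "G n * (expectation (Y n))\<^sup>2 + E n * (\<epsilon> - expectation (Y n))\<^sup>2 \<le> variance (Y n)"
      using work_variance_ge[folded Y_def \<epsilon>_def] by (rule order_trans)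
    show "variance (Y n) \<le> \<epsilon>\<^sup>2 * (2 / (\<kappa> * \<tau>) + 1 / real n)"
      by (rule work_variance_le[folded Y_def \<epsilon>_def])
  qed
  have le: "x \<le> y" if "f \<longlonglongrightarrow> x" "h \<longlonglongrightarrow> y" "\<And>n. n \<ge> N \<Longrightarrow> f n \<le> h n"
    for f h :: "nat \<Rightarrow> real" and x y
    using LIMSEQ_le[OF that(1,2)] that(3) by blast
  show "\<epsilon> * (p0 * exp (- (\<kappa> * \<tau> - A))) \<le> \<mu>"
    by (rule le[OF tendsto_mult_left[OF limE] lim1 est(1)])
  show "\<epsilon> * ((1 - p0) * exp (- A)) \<le> \<epsilon> - \<mu>"
    by (rule le[OF tendsto_mult_left[OF limG] tendsto_diff[OF tendsto_const lim1] est(2)])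
  show "\<epsilon>\<^sup>2 * (p0 * exp (- (\<kappa> * \<tau> - A))) \<le> v + \<mu>\<^sup>2"
    by (rule le[OF tendsto_mult_left[OF limE] lim2 est(3)])
  show "v + \<mu>\<^sup>2 \<le> \<epsilon> * \<mu>"
    by (rule le[OF lim2 tendsto_mult_left[OF lim1] est(4)])
  show "(1 - p0) * exp (- A) * \<mu>\<^sup>2 + p0 * exp (- (\<kappa> * \<tau> - A)) * (\<epsilon> - \<mu>)\<^sup>2 \<le> v"
    by (rule le[OF _ lim_var est(5)]) (intro tendsto_intros limG limE lim1)
  have "(\<lambda>n. \<epsilon>\<^sup>2 * (2 / (\<kappa> * \<tau>) + 1 / real n)) \<longlonglongrightarrow> \<epsilon>\<^sup>2 * (2 / (\<kappa> * \<tau>) + 0)"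
    by (intro tendsto_intros lim_1_over_n)
  then show "v \<le> \<epsilon>\<^sup>2 * (2 / (\<kappa> * \<tau>))"
    using le[OF lim_var _ est(6)] by simp
qed

section \<open>The variance bound and its two limits\<close>

theorem corollary2:
  fixes \<kappa> Th \<delta>min \<delta>max \<epsilon> p0 :: real
    and M :: "real \<Rightarrow> 'a measure"
    and X :: "real \<Rightarrow> nat \<Rightarrow> nat \<Rightarrow> 'a \<Rightarrow> nat"
    and W :: "real \<Rightarrow> 'a \<Rightarrow> real"
  assumes "\<kappa> > 0" and "Th > 0"
    and "0 < \<delta>min" and "\<delta>min < \<delta>max" and "\<epsilon> = \<delta>max - \<delta>min"
    and "0 \<le> p0" and "p0 \<le> 1"
    and "\<And>\<tau>. \<tau> > 0 \<Longrightarrow>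
      continuous_process_work \<kappa> Th p0 (linear_gap \<delta>min \<delta>max \<tau>) \<tau> (M \<tau>) (X \<tau>) (W \<tau>)"
  shows "let \<mu> = (\<lambda>\<tau>. prob_space.expectation (M \<tau>) (W \<tau>));
             var = (\<lambda>\<tau>. prob_space.variance (M \<tau>) (W \<tau>));
             r = partition_function Th \<delta>min / partition_function Th \<delta>max;
             bound = (\<lambda>\<tau>. (1 - p0) * r powr (- (\<kappa> * \<tau> * Th / \<epsilon>)) * (\<mu> \<tau>)\<^sup>2
                         + p0 * exp (- \<kappa> * \<tau>) * r powr (\<kappa> * \<tau> * Th / \<epsilon>) * (\<epsilon> - \<mu> \<tau>)\<^sup>2)
         in (\<forall>\<tau>>0. var \<tau> \<ge> bound \<tau>) \<and>
            (var \<longlongrightarrow> p0 * (1 - p0) * \<epsilon>\<^sup>2) (at_right 0) \<and>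
            (bound \<longlongrightarrow> p0 * (1 - p0) * \<epsilon>\<^sup>2) (at_right 0) \<and>
            (var \<longlongrightarrow> 0) at_top \<and>
            (bound \<longlongrightarrow> 0) at_top"
proof -
  define \<mu> where "\<mu> \<tau> = prob_space.expectation (M \<tau>) (W \<tau>)" for \<tau>
  define v where "v \<tau> = prob_space.variance (M \<tau>) (W \<tau>)" for \<tau>
  define r where "r = partition_function Th \<delta>min / partition_function Th \<delta>max"
  \<comment> \<open>\<open>G\<close> and \<open>E\<close> are the survival factors
    \<open>exp (- A)\<close> and \<open>exp (- (\<kappa> * \<tau> - A))\<close> of the ground and
    the excited state, written as powers of the ratio of partition functions.\<close>
  define G where "G \<tau> = r powr (- (\<kappa> * \<tau> * Th / \<epsilon>))" for \<tau>
  define E where "E \<tau> = exp (- \<kappa> * \<tau>) * r powr (\<kappa> * \<tau> * Th / \<epsilon>)" for \<tau>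
  define bound where "bound \<tau> = (1 - p0) * G \<tau> * (\<mu> \<tau>)\<^sup>2 + p0 * E \<tau> * (\<epsilon> - \<mu> \<tau>)\<^sup>2" for \<tau>
  have \<epsilon>: "\<epsilon> = \<delta>max - \<delta>min" "\<epsilon> > 0" using assms by auto
  have r: "r > 0" by (simp add: r_def partition_function_pos)
  have ln_r: "ln r = ln (partition_function Th \<delta>min) - ln (partition_function Th \<delta>max)"
    unfolding r_def by (intro ln_divide_pos partition_function_pos)
  have G: "G \<tau> = exp (- (\<kappa> * \<tau> * Th / \<epsilon> * ln r))" for \<tau>
    using r by (simp add: G_def powr_def)
  have E: "E \<tau> = exp (- (\<kappa> * \<tau> - \<kappa> * \<tau> * Th / \<epsilon> * ln r))" for \<tau>
    using r by (simp add: E_def powr_def exp_add[symmetric])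
  have b: "\<epsilon> * (p0 * E \<tau>) \<le> \<mu> \<tau>" "\<epsilon> * ((1 - p0) * G \<tau>) \<le> \<epsilon> - \<mu> \<tau>"
    "\<epsilon>\<^sup>2 * (p0 * E \<tau>) \<le> v \<tau> + (\<mu> \<tau>)\<^sup>2" "v \<tau> + (\<mu> \<tau>)\<^sup>2 \<le> \<epsilon> * \<mu> \<tau>" "bound \<tau> \<le> v \<tau>"
    "v \<tau> \<le> \<epsilon>\<^sup>2 * (2 / (\<kappa> * \<tau>))" if "\<tau> > 0" for \<tau>
    using continuous_work_bounds[OF assms(1,2,4,6,7) that assms(8)[OF that]]
    unfolding bound_def G E ln_r \<epsilon>(1) \<mu>_def v_def by simp_all
  have bound_nonneg: "0 \<le> bound \<tau>" for \<tau>
    using assms by (simp add: bound_def G E)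

  have pos: "\<forall>\<^sub>F \<tau> in at_right 0. \<tau> > (0 :: real)"
    by (rule eventually_at_right_less)
  have id0: "((\<lambda>\<tau>. \<tau>) \<longlongrightarrow> (0 :: real)) (at_right 0)"
    by (rule tendsto_ident_at)
  have "(G \<longlongrightarrow> exp (- (\<kappa> * 0 * Th / \<epsilon> * ln r))) (at_right 0)"
    unfolding G[abs_def] using \<epsilon> by (intro tendsto_intros id0) auto
  then have limG: "(G \<longlongrightarrow> 1) (at_right 0)" by simp
  have "(E \<longlongrightarrow> exp (- (\<kappa> * 0 - \<kappa> * 0 * Th / \<epsilon> * ln r))) (at_right 0)"
    unfolding E[abs_def] using \<epsilon> by (intro tendsto_intros id0) auto
  then have limE: "(E \<longlongrightarrow> 1) (at_right 0)" by simp
  \<comment> \<open>Both survival factors tend to 1, so the lower and the upper estimate of the mean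
    meet at \<open>\<epsilon> * p0\<close>.\<close>
  have lim\<mu>: "(\<mu> \<longlongrightarrow> \<epsilon> * p0) (at_right 0)"
  proof (rule tendsto_sandwich)
    show "\<forall>\<^sub>F \<tau> in at_right 0. \<epsilon> * (p0 * E \<tau>) \<le> \<mu> \<tau>"
      using pos by eventually_elim (rule b(1))
    show "\<forall>\<^sub>F \<tau> in at_right 0. \<mu> \<tau> \<le> \<epsilon> - \<epsilon> * ((1 - p0) * G \<tau>)"
      using pos by eventually_elim (use b(2) in force)
    have "((\<lambda>\<tau>. \<epsilon> * (p0 * E \<tau>)) \<longlongrightarrow> \<epsilon> * (p0 * 1)) (at_right 0)"
      by (intro tendsto_intros limE)
    then show "((\<lambda>\<tau>. \<epsilon> * (p0 * E \<tau>)) \<longlongrightarrow> \<epsilon> * p0) (at_right 0)" by simp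
    have "((\<lambda>\<tau>. \<epsilon> - \<epsilon> * ((1 - p0) * G \<tau>)) \<longlongrightarrow> \<epsilon> - \<epsilon> * ((1 - p0) * 1)) (at_right 0)"
      by (intro tendsto_intros limG)
    then show "((\<lambda>\<tau>. \<epsilon> - \<epsilon> * ((1 - p0) * G \<tau>)) \<longlongrightarrow> \<epsilon> * p0) (at_right 0)"
      by (simp add: algebra_simps)
  qed
  \<comment> \<open>The second moment lies between
    \<open>\<epsilon>\<^sup>2 * (p0 * E \<tau>)\<close> and
    \<open>\<epsilon> * \<mu> \<tau>\<close>, which share the limit
    \<open>\<epsilon>\<^sup>2 * p0\<close>.\<close>
  have v0: "(v \<longlongrightarrow> p0 * (1 - p0) * \<epsilon>\<^sup>2) (at_right 0)"
  proof (rule tendsto_sandwich)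
    show "\<forall>\<^sub>F \<tau> in at_right 0. \<epsilon>\<^sup>2 * (p0 * E \<tau>) - (\<mu> \<tau>)\<^sup>2 \<le> v \<tau>"
      using pos by eventually_elim (use b(3) in force)
    show "\<forall>\<^sub>F \<tau> in at_right 0. v \<tau> \<le> \<epsilon> * \<mu> \<tau> - (\<mu> \<tau>)\<^sup>2"
      using pos by eventually_elim (use b(4) in force)
    have "((\<lambda>\<tau>. \<epsilon>\<^sup>2 * (p0 * E \<tau>) - (\<mu> \<tau>)\<^sup>2) \<longlongrightarrow> \<epsilon>\<^sup>2 * (p0 * 1) - (\<epsilon> * p0)\<^sup>2) (at_right 0)"
      by (intro tendsto_intros limE lim\<mu>)
    then show "((\<lambda>\<tau>. \<epsilon>\<^sup>2 * (p0 * E \<tau>) - (\<mu> \<tau>)\<^sup>2) \<longlongrightarrow> p0 * (1 - p0) * \<epsilon>\<^sup>2) (at_right 0)"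
      by (simp add: algebra_simps power2_eq_square)
    have "((\<lambda>\<tau>. \<epsilon> * \<mu> \<tau> - (\<mu> \<tau>)\<^sup>2) \<longlongrightarrow> \<epsilon> * (\<epsilon> * p0) - (\<epsilon> * p0)\<^sup>2) (at_right 0)"
      by (intro tendsto_intros lim\<mu>)
    then show "((\<lambda>\<tau>. \<epsilon> * \<mu> \<tau> - (\<mu> \<tau>)\<^sup>2) \<longlongrightarrow> p0 * (1 - p0) * \<epsilon>\<^sup>2) (at_right 0)"
      by (simp add: algebra_simps power2_eq_square)
  qed
  \<comment> \<open>Saturation rests on \<open>(1 - p0) * p0\<^sup>2 + p0 * (1 - p0)\<^sup>2 = p0 *
    (1 - p0)\<close>.\<close>
  have "(bound \<longlongrightarrow> (1 - p0) * 1 * (\<epsilon> * p0)\<^sup>2 + p0 * 1 * (\<epsilon> - \<epsilon> * p0)\<^sup>2) (at_right 0)"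
    unfolding bound_def[abs_def] by (intro tendsto_intros limG limE lim\<mu>)
  then have bound0: "(bound \<longlongrightarrow> p0 * (1 - p0) * \<epsilon>\<^sup>2) (at_right 0)"
    by (simp add: algebra_simps power2_eq_square)

  have "((\<lambda>\<tau>. \<epsilon>\<^sup>2 * (2 / (\<kappa> * \<tau>))) \<longlongrightarrow> \<epsilon>\<^sup>2 * 0) at_top"
    using assms(1)
    by (intro tendsto_intros tendsto_divide_0[OF tendsto_const] filterlim_at_top_imp_at_infinity
        filterlim_tendsto_pos_mult_at_top[OF tendsto_const _ filterlim_ident])
  then have upper: "((\<lambda>\<tau>. \<epsilon>\<^sup>2 * (2 / (\<kappa> * \<tau>))) \<longlongrightarrow> 0) at_top" by simp
  have pos': "\<forall>\<^sub>F \<tau> in at_top. \<tau> > (0 :: real)"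
    by (rule eventually_gt_at_top)
  have v_nonneg: "\<forall>\<^sub>F \<tau> in at_top. 0 \<le> v \<tau>"
    using pos' by eventually_elim (rule order_trans[OF bound_nonneg b(5)])
  have v1: "(v \<longlongrightarrow> 0) at_top"
  proof (rule tendsto_sandwich[OF v_nonneg _ tendsto_const upper])
    show "\<forall>\<^sub>F \<tau> in at_top. v \<tau> \<le> \<epsilon>\<^sup>2 * (2 / (\<kappa> * \<tau>))"
      using pos' by eventually_elim (rule b(6))
  qed
  \<comment> \<open>The bound lies between 0 and the variance, so its limit follows without
    computing the isothermal mean.\<close>
  have bound1: "(bound \<longlongrightarrow> 0) at_top"
  proof (rule tendsto_sandwich[OF _ _ tendsto_const v1])
    show "\<forall>\<^sub>F \<tau> in at_top. 0 \<le> bound \<tau>"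
      by (simp add: bound_nonneg)
    show "\<forall>\<^sub>F \<tau> in at_top. bound \<tau> \<le> v \<tau>"
      using pos' by eventually_elim (rule b(5))
  qed

  have "(\<forall>\<tau>>0. v \<tau> \<ge> bound \<tau>) \<and> (v \<longlongrightarrow> p0 * (1 - p0) * \<epsilon>\<^sup>2) (at_right 0) \<and>
      (bound \<longlongrightarrow> p0 * (1 - p0) * \<epsilon>\<^sup>2) (at_right 0) \<and> (v \<longlongrightarrow> 0) at_top \<and> (bound \<longlongrightarrow> 0) at_top"
    using b(5) v0 bound0 v1 bound1 by blast
  then show ?thesis
    unfolding Let_def bound_def[abs_def] G_def E_def r_def \<mu>_def[abs_def] v_def[abs_def]
    by (simp only: mult.assoc, blast)
qed

end
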